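(* Let $W_0:\mathbb{R}^d\times\mathcal{P}_2(\mathbb{R}^d)\to\mathbb{R}^d$ and $F,G:\mathbb{R}^d\times\mathcal{P}_2(\mathbb{R}^d)\times\mathbb{R}^d\to\mathbb{R}^d$ be continuous. Assume: (1) there is a constant $C_1$ with $|W_0(x,\mu)|+|F(x,\mu,u)|+|G(x,\mu,u)|\le C_1(1+|x|+|u|+\sqrt{E_2(\mu)})$ for all $(x,\mu,u)$; (2) there exist $\alpha>0$, $L\ge0$, $a_0>0$ such that for all $X,Y,U,V\in\mathcal{H}$: $\langle\tilde W_0(X)-\tilde W_0(Y),X-Y\rangle\ge a_0\|\tilde W_0(X)-\tilde W_0(Y)\|^2$; $\langle\tilde G(X,U)-\tilde G(Y,V),X-Y\rangle+\langle\tilde F(X,U)-\tilde F(Y,V),U-V\rangle\ge0$; $\langle\tilde G(X,U)-\tilde G(Y,V),X-Y\rangle+\langle\tilde F(X,U)-\tilde F(Y,V),U-V\rangle\ge\alpha\|X-Y\|^2-L\|U-V\|^2$; (3) there exist $\gamma\in(0,1]$, a constant $C_2$ and a modulus of continuity $\omega$ such that for all $X,Y,U,V\in\mathcal{H}$: $\langle\tilde G(X,U)-\tilde G(Y,V),U-V\rangle\le C_2(\|X-Y\|^2+\|U-V\|^2)$; $\langle\tilde F(X,U)-\tilde F(Y,V),X-Y\rangle\ge-C_2(\|X-Y\|^2+\|U-V\|_\gamma^2)$; and for all $x,u\in\mathbb{R}^d$, $\mu,\nu\in\mathcal{P}_2(\mathbb{R}^d)$: $|F(x,\mu,u)-F(x,\nu,u)|+|G(x,\mu,u)-G(x,\nu,u)|+|W_0(x,\mu)-W_0(x,\nu)|\le\omega(\mathcal{W}_2(\mu,\nu))$.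 Then there exists a constant $C$ such that, whenever $(X,W^x,Z^x)$ and $(Y,W^y,Z^y)$ are strong solutions on $[0,T]$ of $$X_t=X_0-\int_0^t\tilde F(X_s,W_s)ds+\sigma_xB_t,\qquad W_t=\tilde W_0(X_T)+\int_t^T\tilde G(X_s,W_s)ds-\int_t^TZ_sdB_s$$ with initial data $X_0\in\mathcal{H}$ and $Y_0\in\mathcal{H}$ respectively, $$\forall t\le T,\quad\|X_t-Y_t\|\le C\|X_0-Y_0\|_\gamma.$$
   Context: Fix $d\ge1$, $T>0$, $\sigma_x\ge0$ and a sufficiently rich probability space. $\mathcal{H}=L^2(\Omega,\mathbb{R}^d)$ with $\langle X,Y\rangle=\mathbb{E}[X\cdot Y]$, norm $\|\cdot\|$; $\|X-Y\|_\gamma=\max(\|X-Y\|,\|X-Y\|^\gamma)$; $\mathcal{L}(X)$ is the law of $X$; $\mathcal{P}_2(\mathbb{R}^d)$ carries $\mathcal{W}_2$; $E_2(\mu)=\int|y|^2\mu(dy)$. A modulus of continuity is a continuous increasing $\omega:\mathbb{R}^+\to\mathbb{R}^+$ with $\omega(0)=0$. Lifts: $\tilde W_0(X)=W_0(X,\mathcal{L}(X))$, $\tilde F(X,U)=F(X,\mathcal{L}(X),U)$, $\tilde G(X,U)=G(X,\mathcal{L}(X),U)$. $B$ is a $d$-dimensional Brownian motion (the same for both solutions) with respect to a filtration for which $X_0,Y_0$ are measurable at time $0$. A strong solution is a triple of adapted, square integrable processes (with $X_t,W_t\in\mathcal{H}$ and $Z$ square integrable with respect to $dt\otimes\mathbb{P}$)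 satisfying the system. The constant $C$ depends only on the data ($F,G,W_0,T$), not on the solutions. *)

theory Defs
  imports "HOL-Probability.Probability"
begin

section \<open>Square integrable functions\<close>

text \<open>
  Elements of $L^2$ are represented by functions, not by classes modulo null sets;
  all quantities below depend on the class only.
\<close>

definition square_integrable :: "'a measure \<Rightarrow> ('a \<Rightarrow> 'b::euclidean_space) \<Rightarrow> bool" where
  "square_integrable M X \<longleftrightarrow> X \<in> borel_measurable M \<and> integrable M (\<lambda>x. (norm (X x))\<^sup>2)"

definition l2_inner :: "'a measure \<Rightarrow> ('a \<Rightarrow> 'b::euclidean_space) \<Rightarrow> ('a \<Rightarrow> 'b) \<Rightarrow> real" where
  "l2_inner M X Y = (LINT x|M. X x \<bullet> Y x)"

definition l2_norm :: "'a measure \<Rightarrow> ('a \<Rightarrow> 'b::euclidean_space) \<Rightarrow> real" where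
  "l2_norm M X = sqrt (LINT x|M. (norm (X x))\<^sup>2)"

definition l2_dist :: "'a measure \<Rightarrow> ('a \<Rightarrow> 'b::euclidean_space) \<Rightarrow> ('a \<Rightarrow> 'b) \<Rightarrow> real" where
  "l2_dist M X Y = l2_norm M (\<lambda>x. X x - Y x)"

definition l2_dist_pow :: "real \<Rightarrow> 'a measure \<Rightarrow> ('a \<Rightarrow> 'b::euclidean_space) \<Rightarrow> ('a \<Rightarrow> 'b) \<Rightarrow> real" where
  "l2_dist_pow \<gamma> M X Y = max (l2_dist M X Y) (l2_dist M X Y powr \<gamma>)"


section \<open>The Wasserstein space\<close>

definition P2 :: "'b::euclidean_space measure set" where
  "P2 = {\<mu>. prob_space \<mu> \<and> sets \<mu> = sets borel \<and> integrable \<mu> (\<lambda>y. (norm y)\<^sup>2)}"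

definition E2 :: "'b::euclidean_space measure \<Rightarrow> real" where
  "E2 \<mu> = (LINT y|\<mu>. (norm y)\<^sup>2)"

definition couplings :: "'b::euclidean_space measure \<Rightarrow> 'b measure \<Rightarrow> ('b \<times> 'b) measure set" where
  "couplings \<mu> \<nu> = {\<pi>. sets \<pi> = sets (borel \<Otimes>\<^sub>M borel) \<and>
     distr \<pi> borel fst = \<mu> \<and> distr \<pi> borel snd = \<nu>}"

text \<open>Only used on \<^const>\<open>P2\<close>, where the set of costs is nonempty and the integrals are finite.\<close>

definition wasserstein2 :: "'b::euclidean_space measure \<Rightarrow> 'b measure \<Rightarrow> real" where
  "wasserstein2 \<mu> \<nu> = sqrt (INF \<pi>\<in>couplings \<mu> \<nu>. LINT p|\<pi>. (norm (fst p - snd p))\<^sup>2)"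

definition continuous_P2 ::
  "('b::metric_space \<Rightarrow> 'c::euclidean_space measure \<Rightarrow> 'd::metric_space) \<Rightarrow> bool" where
  "continuous_P2 f \<longleftrightarrow>
     (\<forall>x. \<forall>\<mu>\<in>P2. \<forall>e>0. \<exists>d>0. \<forall>y. \<forall>\<nu>\<in>P2.
        dist x y < d \<and> wasserstein2 \<mu> \<nu> < d \<longrightarrow> dist (f x \<mu>) (f y \<nu>) < e)"

definition modulus_of_continuity :: "(real \<Rightarrow> real) \<Rightarrow> bool" where
  "modulus_of_continuity \<omega> \<longleftrightarrow> continuous_on {0..} \<omega> \<and> mono_on {0..} \<omega> \<and> \<omega> 0 = 0"


section \<open>Lifts to the space of random variables\<close>

definition law :: "'a measure \<Rightarrow> ('a \<Rightarrow> 'b::euclidean_space) \<Rightarrow> 'b measure" where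
  "law M X = distr M borel X"

definition lift1 ::
  "'a measure \<Rightarrow> ('b::euclidean_space \<Rightarrow> 'b measure \<Rightarrow> 'b) \<Rightarrow> ('a \<Rightarrow> 'b) \<Rightarrow> 'a \<Rightarrow> 'b" where
  "lift1 M f X = (\<lambda>\<omega>. f (X \<omega>) (law M X))"

definition lift2 ::
  "'a measure \<Rightarrow> ('b::euclidean_space \<Rightarrow> 'b measure \<Rightarrow> 'b \<Rightarrow> 'b) \<Rightarrow> ('a \<Rightarrow> 'b) \<Rightarrow> ('a \<Rightarrow> 'b) \<Rightarrow> 'a \<Rightarrow> 'b"
  where "lift2 M f X U = (\<lambda>\<omega>. f (X \<omega>) (law M X) (U \<omega>))"


section \<open>Brownian motion and the It\^o integral\<close>

text \<open>
  The values of a filtration at negative times play no role.  No completeness or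
  right-continuity is imposed.
\<close>

definition filtered :: "'a measure \<Rightarrow> (real \<Rightarrow> 'a measure) \<Rightarrow> bool" where
  "filtered M \<F> \<longleftrightarrow> filtration (space M) \<F> \<and> (\<forall>t. subalgebra M (\<F> t))"

definition adapted_on ::
  "(real \<Rightarrow> 'a measure) \<Rightarrow> real \<Rightarrow> (real \<Rightarrow> 'a \<Rightarrow> 'b::euclidean_space) \<Rightarrow> bool" where
  "adapted_on \<F> T X \<longleftrightarrow> (\<forall>t\<in>{0..T}. X t \<in> borel_measurable (\<F> t))"

definition brownian_motion_on ::
  "'a measure \<Rightarrow> (real \<Rightarrow> 'a measure) \<Rightarrow> real \<Rightarrow> (real \<Rightarrow> 'a \<Rightarrow> real ^ 'n) \<Rightarrow> bool" where
  "brownian_motion_on M \<F> T B \<longleftrightarrow>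
     adapted_on \<F> T B \<and>
     (AE \<omega> in M. B 0 \<omega> = 0) \<and>
     (AE \<omega> in M. continuous_on {0..T} (\<lambda>t. B t \<omega>)) \<and>
     (\<forall>s t. 0 \<le> s \<and> s < t \<and> t \<le> T \<longrightarrow>
        prob_space.indep_set M (sets (\<F> s))
          (sets (vimage_algebra (space M) (\<lambda>\<omega>. B t \<omega> - B s \<omega>) borel)) \<and>
        distributed M lborel (\<lambda>\<omega>. B t \<omega> - B s \<omega>)
          (\<lambda>x. ennreal (\<Prod>i\<in>UNIV. normal_density 0 (sqrt (t - s)) (x $ i))))"

definition time_prod :: "real \<Rightarrow> real \<Rightarrow> 'a measure \<Rightarrow> (real \<times> 'a) measure" where
  "time_prod a b M = restrict_space lborel {a..b} \<Otimes>\<^sub>M M"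

text \<open>
  A simple integrand on $[a,b]$ is
  $\sum_{k<n} \xi_k 1_{(\tau_k, \tau_{k+1}]}$ with $a \le \tau_0 \le \dots \le \tau_n \le b$ and bounded
  $\mathcal{F}_{\tau_k}$-measurable matrices $\xi_k$.
\<close>

definition simple_integrand ::
  "(real \<Rightarrow> 'a measure) \<Rightarrow> real \<Rightarrow> real \<Rightarrow> nat \<Rightarrow> (nat \<Rightarrow> real) \<Rightarrow> (nat \<Rightarrow> 'a \<Rightarrow> real ^ 'n ^ 'n) \<Rightarrow> bool" where
  "simple_integrand \<F> a b n \<tau> \<xi> \<longleftrightarrow>
     a \<le> \<tau> 0 \<and> \<tau> n \<le> b \<and> (\<forall>k<n. \<tau> k \<le> \<tau> (Suc k)) \<and>
     (\<forall>k<n. \<xi> k \<in> borel_measurable (\<F> (\<tau> k)) \<and> (\<exists>c. \<forall>\<omega>\<in>space (\<F> (\<tau> k)). norm (\<xi> k \<omega>) \<le> c))"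

definition simple_process ::
  "nat \<Rightarrow> (nat \<Rightarrow> real) \<Rightarrow> (nat \<Rightarrow> 'a \<Rightarrow> real ^ 'n ^ 'n) \<Rightarrow> real \<Rightarrow> 'a \<Rightarrow> real ^ 'n ^ 'n" where
  "simple_process n \<tau> \<xi> s \<omega> = (\<Sum>k<n. indicator {\<tau> k<..\<tau> (Suc k)} s *\<^sub>R \<xi> k \<omega>)"

definition simple_ito ::
  "(real \<Rightarrow> 'a \<Rightarrow> real ^ 'n) \<Rightarrow> nat \<Rightarrow> (nat \<Rightarrow> real) \<Rightarrow> (nat \<Rightarrow> 'a \<Rightarrow> real ^ 'n ^ 'n) \<Rightarrow> 'a \<Rightarrow> real ^ 'n" where
  "simple_ito B n \<tau> \<xi> \<omega> = (\<Sum>k<n. \<xi> k \<omega> *v (B (\<tau> (Suc k)) \<omega> - B (\<tau> k) \<omega>))"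

text \<open>
  \<open>has_ito_integral M \<F> B Z a b I\<close>: the random variable \<open>I\<close> is (a version of)
  $\int_a^b Z_s\,dB_s$, i.e.\ the $L^2$-limit of the integrals of simple integrands converging
  to \<open>Z\<close> in $L^2(dt \otimes P)$.  By the It\^o isometry \<open>I\<close> is unique up to null sets.
\<close>

definition has_ito_integral ::
  "'a measure \<Rightarrow> (real \<Rightarrow> 'a measure) \<Rightarrow> (real \<Rightarrow> 'a \<Rightarrow> real ^ 'n) \<Rightarrow>
   (real \<Rightarrow> 'a \<Rightarrow> real ^ 'n ^ 'n) \<Rightarrow> real \<Rightarrow> real \<Rightarrow> ('a \<Rightarrow> real ^ 'n) \<Rightarrow> bool" where
  "has_ito_integral M \<F> B Z a b I \<longleftrightarrow>
     square_integrable (time_prod a b M) (case_prod Z) \<and>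
     square_integrable M I \<and>
     (\<exists>n \<tau> \<xi>.
        (\<forall>m. simple_integrand \<F> a b (n m) (\<tau> m) (\<xi> m)) \<and>
        (\<lambda>m. l2_dist (time_prod a b M) (case_prod Z) (case_prod (simple_process (n m) (\<tau> m) (\<xi> m))))
          \<longlonglongrightarrow> 0 \<and>
        (\<lambda>m. l2_dist M I (simple_ito B (n m) (\<tau> m) (\<xi> m))) \<longlonglongrightarrow> 0)"


section \<open>Strong solutions of the forward-backward system\<close>

text \<open>
  The equations are required for every \<open>t\<close>, almost surely; path continuity is not imposed.
  Integrability of the two drifts on the product space makes the time integrals meaningful
  (\<^const>\<open>lebesgue_integral\<close> is 0 on non-integrable functions).  For continuous coefficients of
  linear growth it follows from the square integrability of the processes.
\<close>

definition strong_solution ::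
  "'a measure \<Rightarrow> (real \<Rightarrow> 'a measure) \<Rightarrow> real \<Rightarrow> (real \<Rightarrow> 'a \<Rightarrow> real ^ 'n) \<Rightarrow> real \<Rightarrow>
   (real ^ 'n \<Rightarrow> (real ^ 'n) measure \<Rightarrow> real ^ 'n) \<Rightarrow>
   (real ^ 'n \<Rightarrow> (real ^ 'n) measure \<Rightarrow> real ^ 'n \<Rightarrow> real ^ 'n) \<Rightarrow>
   (real ^ 'n \<Rightarrow> (real ^ 'n) measure \<Rightarrow> real ^ 'n \<Rightarrow> real ^ 'n) \<Rightarrow>
   ('a \<Rightarrow> real ^ 'n) \<Rightarrow>
   (real \<Rightarrow> 'a \<Rightarrow> real ^ 'n) \<Rightarrow> (real \<Rightarrow> 'a \<Rightarrow> real ^ 'n) \<Rightarrow> (real \<Rightarrow> 'a \<Rightarrow> real ^ 'n ^ 'n) \<Rightarrow> bool" where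
  "strong_solution M \<F> T B \<sigma> W\<^sub>0 F G X\<^sub>0 X W Z \<longleftrightarrow>
     adapted_on \<F> T X \<and> adapted_on \<F> T W \<and> adapted_on \<F> T Z \<and>
     (\<forall>t\<in>{0..T}. square_integrable M (X t) \<and> square_integrable M (W t)) \<and>
     square_integrable (time_prod 0 T M) (case_prod X) \<and>
     square_integrable (time_prod 0 T M) (case_prod W) \<and>
     square_integrable (time_prod 0 T M) (case_prod Z) \<and>
     integrable (time_prod 0 T M) (\<lambda>(s, \<omega>). lift2 M F (X s) (W s) \<omega>) \<and>
     integrable (time_prod 0 T M) (\<lambda>(s, \<omega>). lift2 M G (X s) (W s) \<omega>) \<and>
     (\<forall>t\<in>{0..T}. AE \<omega> in M.
        X t \<omega> = X\<^sub>0 \<omega> - (LINT s:{0..t}|lborel. lift2 M F (X s) (W s) \<omega>) + \<sigma> *\<^sub>R B t \<omega>) \<and>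
     (\<forall>t\<in>{0..T}. \<exists>I. has_ito_integral M \<F> B Z t T I \<and>
        (AE \<omega> in M.
           W t \<omega> = lift1 M W\<^sub>0 (X T) \<omega> + (LINT s:{t..T}|lborel. lift2 M G (X s) (W s) \<omega>) - I \<omega>))"

end

theory Submission
  imports Defs
begin

text \<open>
  Let $D = X - Y$ and $E = W^x - W^y$ be the differences of the two solutions, and let $f$ and $g$
  be the corresponding differences of the drifts $\tilde F$ and $\tilde G$.  The noise
  $\sigma_x B$ is common, so $D' = -f$, while $E$ solves a backward equation with drift $-g$.  The
  key quantity is the pairing $\psi(t) = \langle D_t, E_t\rangle$, whose derivative is
  $-(\langle f, E\rangle + \langle g, D\rangle)$.  By monotonicity $\psi$ is nonincreasing, and
  monotonicity of $\tilde W_0$ gives $\psi(T) \ge a_0 \|\tilde W_0(X_T) - \tilde W_0(Y_T)\|^2$.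
  Integrating the strong monotonicity bounds $\int_t^T \|D\|^2$ by $\psi(0)$ and
  $\int_t^T \|E\|^2$.  Inserted into the backward energy inequality for $\|E_t\|^2$, whose drift
  term $\langle g, E\rangle$ is bounded by $\|D\|^2 + \|E\|^2$, this yields
  $\|E_t\|^2 \le k\,\psi(0) + K \int_t^T \|E\|^2$, and Gronwall gives
  $\|E_t\|^2 \le R\,\psi(0) \le R\,\|D_0\|\,\|E_0\|$.  At $t = 0$ this reads
  $\|E_0\| \le R\,\|D_0\|$, hence $\|E_t\| \le R\,\|D_0\|$ for all $t$.  Now the forward energy
  identity for $\|D_t\|^2$, the lower bound on $\langle f, D\rangle$ and a second use of Gronwall
  give the result.

  The pairings are differentiated through the curve $Q_t = E_t + I_t$, where $I_t$ is the
  difference of the stochastic integrals over $[t,T]$.  It is not adapted, but it equals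
  $\tilde W_0(X_T) - \tilde W_0(Y_T) + \int_t^T g$ and so is absolutely continuous in $L^2$ with
  derivative $-g$.  Since $I_t$ is orthogonal to all square integrable $\mathcal{F}_t$-measurable
  variables (\<open>ito_integral_orthogonal\<close>), and $D_t$, $E_t$, $f_t$, $g_t$ are such variables,
  their pairings with $E_t$ and with $Q_t$ agree, and $\|E_t\| \le \|Q_t\|$.  What remains is the
  product rule for two absolutely continuous curves in $L^2$ (\<open>l2_product_rule\<close>), which is
  Fubini's theorem on a triangle.  The estimate itself is then a statement about curves in $L^2$
  (\<open>forward_backward_estimate\<close>).
\<close>


section \<open>Pairings of square integrable functions\<close>

lemma square_integrableD:
  assumes "square_integrable M X"
  shows "X \<in> borel_measurable M" "integrable M (\<lambda>x. (norm (X x))\<^sup>2)"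
  using assms by (auto simp: square_integrable_def)

lemma square_integrable_bound:
  fixes X :: "'a \<Rightarrow> 'b::euclidean_space"
  assumes "X \<in> borel_measurable M" "integrable M h" "\<And>x. x \<in> space M \<Longrightarrow> (norm (X x))\<^sup>2 \<le> h x"
  shows "square_integrable M X"
  unfolding square_integrable_def
proof
  show "integrable M (\<lambda>x. (norm (X x))\<^sup>2)"
    by (rule Bochner_Integration.integrable_bound[OF assms(2)])
      (use assms(1,3) in \<open>auto intro!: order_trans[OF assms(3) abs_ge_self]\<close>)
qed (fact assms)

lemma norm_sum_square_le:
  fixes a b :: "'b::real_normed_vector"
  shows "(norm (a + b))\<^sup>2 \<le> 2 * (norm a)\<^sup>2 + 2 * (norm b)\<^sup>2"
proof -
  have "(norm (a + b))\<^sup>2 \<le> (norm a + norm b)\<^sup>2"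
    by (intro power_mono norm_triangle_ineq) auto
  also have "\<dots> \<le> 2 * (norm a)\<^sup>2 + 2 * (norm b)\<^sup>2"
    using sum_squares_bound[of "norm a" "norm b"] by (simp add: power2_sum)
  finally show ?thesis .
qed

lemma square_integrable_add:
  assumes "square_integrable M X" "square_integrable M Y"
  shows "square_integrable M (\<lambda>x. X x + Y x)"
  using assms[THEN square_integrableD(1)] assms[THEN square_integrableD(2)]
  by (intro square_integrable_bound[where h = "\<lambda>x. 2 * (norm (X x))\<^sup>2 + 2 * (norm (Y x))\<^sup>2"])
    (auto intro: norm_sum_square_le)

lemma square_integrable_scaleR:
  assumes "square_integrable M X"
  shows "square_integrable M (\<lambda>x. c *\<^sub>R X x)"
  using assms by (auto simp: square_integrable_def power_mult_distrib)

lemma square_integrable_diff: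
  assumes "square_integrable M X" "square_integrable M Y"
  shows "square_integrable M (\<lambda>x. X x - Y x)"
  using square_integrable_add[OF assms(1) square_integrable_scaleR[OF assms(2), of "-1"]] by simp

lemma square_integrable_minus:
  assumes "square_integrable M X"
  shows "square_integrable M (\<lambda>x. - X x)"
  using assms by (auto simp: square_integrable_def)

lemma square_integrable_sum:
  assumes "finite I" "\<And>i. i \<in> I \<Longrightarrow> square_integrable M (X i)"
  shows "square_integrable M (\<lambda>x. \<Sum>i\<in>I. X i x)"
  using assms
proof (induction I)
  case empty
  then show ?case by (simp add: square_integrable_def)
next
  case (insert i I)
  then show ?case by (simp add: square_integrable_add)
qed

lemma abs_inner_le_squares:
  fixes a b :: "'b::real_inner"
  shows "\<bar>a \<bullet> b\<bar> \<le> (norm a)\<^sup>2 + (norm b)\<^sup>2"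
proof -
  have "\<bar>a \<bullet> b\<bar> \<le> norm a * norm b" by (rule Cauchy_Schwarz_ineq2)
  also have "\<dots> \<le> (norm a)\<^sup>2 + (norm b)\<^sup>2"
    using sum_squares_bound[of "norm a" "norm b"] mult_nonneg_nonneg[of "norm a" "norm b"]
    by (simp del: mult_nonneg_nonneg)
  finally show ?thesis .
qed

lemma integrable_inner:
  assumes "square_integrable M X" "square_integrable M Y"
  shows "integrable M (\<lambda>x. X x \<bullet> Y x)"
  by (rule Bochner_Integration.integrable_bound[where f = "\<lambda>x. (norm (X x))\<^sup>2 + (norm (Y x))\<^sup>2"])
    (use assms abs_inner_le_squares in \<open>auto simp: square_integrable_def intro!: AE_I2\<close>)

lemma square_integrable_integrable:
  assumes "finite_measure M" "square_integrable M X"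
  shows "integrable M X"
proof -
  have "integrable M (\<lambda>x. norm (X x))"
    by (rule finite_measure.square_integrable_imp_integrable[OF assms(1)])
      (use assms(2) in \<open>auto simp: square_integrable_def\<close>)
  then show ?thesis
    using assms(2) by (auto simp: square_integrable_def integrable_norm_iff)
qed

lemma l2_inner_commute: "l2_inner M X Y = l2_inner M Y X"
  by (simp add: l2_inner_def inner_commute)

lemma l2_inner_add_left:
  assumes "square_integrable M X" "square_integrable M Y" "square_integrable M V"
  shows "l2_inner M (\<lambda>x. X x + Y x) V = l2_inner M X V + l2_inner M Y V"
  using assms by (simp add: l2_inner_def inner_add_left integrable_inner)

lemma l2_inner_diff_left:
  assumes "square_integrable M X" "square_integrable M Y" "square_integrable M V"
  shows "l2_inner M (\<lambda>x. X x - Y x) V = l2_inner M X V - l2_inner M Y V"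
  using assms by (simp add: l2_inner_def inner_diff_left integrable_inner)

lemma l2_inner_add_right:
  assumes "square_integrable M X" "square_integrable M Y" "square_integrable M V"
  shows "l2_inner M V (\<lambda>x. X x + Y x) = l2_inner M V X + l2_inner M V Y"
  using assms by (simp add: l2_inner_def inner_add_right integrable_inner)

lemma l2_inner_diff_right:
  assumes "square_integrable M X" "square_integrable M Y" "square_integrable M V"
  shows "l2_inner M V (\<lambda>x. X x - Y x) = l2_inner M V X - l2_inner M V Y"
  using assms by (simp add: l2_inner_def inner_diff_right integrable_inner)

lemma l2_inner_minus_left: "l2_inner M (\<lambda>x. - X x) V = - l2_inner M X V"
  by (simp add: l2_inner_def)

lemma l2_inner_sum_right:
  assumes "finite I" "\<And>i. i \<in> I \<Longrightarrow> square_integrable M (X i)" "square_integrable M V"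
  shows "l2_inner M V (\<lambda>x. \<Sum>i\<in>I. X i x) = (\<Sum>i\<in>I. l2_inner M V (X i))"
  using assms by (simp add: l2_inner_def inner_sum_right integrable_inner)

lemma l2_inner_cong_AE:
  assumes "AE x in M. X x = Y x"
    and [measurable]: "X \<in> borel_measurable M" "Y \<in> borel_measurable M" "V \<in> borel_measurable M"
  shows "l2_inner M X V = l2_inner M Y V"
  unfolding l2_inner_def
  by (rule integral_cong_AE) (use assms(1) in auto)

lemma l2_norm_nonneg: "0 \<le> l2_norm M X"
  by (simp add: l2_norm_def integral_nonneg_AE)

lemma l2_norm_square: "(l2_norm M X)\<^sup>2 = l2_inner M X X"
  by (simp add: l2_norm_def l2_inner_def power2_norm_eq_inner integral_nonneg_AE)

lemma l2_norm_cong_AE: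
  assumes "AE x in M. X x = Y x" "X \<in> borel_measurable M" "Y \<in> borel_measurable M"
  shows "l2_norm M X = l2_norm M Y"
  unfolding l2_norm_def
  by (intro arg_cong[where f = sqrt] integral_cong_AE) (use assms in auto)

text \<open>
  Cauchy--Schwarz, from the discriminant of the nonnegative quadratic polynomial
  $t \mapsto \|X + tY\|^2$.
\<close>

lemma l2_inner_le:
  assumes X: "square_integrable M X" and Y: "square_integrable M Y"
  shows "\<bar>l2_inner M X Y\<bar> \<le> l2_norm M X * l2_norm M Y"
proof -
  let ?a = "l2_inner M X X" and ?b = "l2_inner M X Y" and ?c = "l2_inner M Y Y"
  have quad: "0 \<le> ?a + 2 * t * ?b + t\<^sup>2 * ?c" for t :: real
  proof -
    have "0 \<le> l2_inner M (\<lambda>x. X x + t *\<^sub>R Y x) (\<lambda>x. X x + t *\<^sub>R Y x)"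
      by (simp add: l2_norm_square[symmetric])
    also have "\<dots> = ?a + 2 * t * ?b + t\<^sup>2 * ?c"
      using integrable_inner[OF X X] integrable_inner[OF X Y] integrable_inner[OF Y Y]
      by (simp add: l2_inner_def inner_add_left inner_add_right inner_commute[of "Y _" "X _"]
          power2_eq_square distrib_left mult.assoc)
    finally show ?thesis .
  qed
  have ac: "0 \<le> ?a" "0 \<le> ?c" by (simp_all add: l2_norm_square[symmetric])
  have "?b\<^sup>2 \<le> ?a * ?c"
  proof (cases "?c = 0")
    case True
    \<comment> \<open>the polynomial is then affine; this choice of \<open>t\<close> would give it the value $-1$\<close>
    then have "?b = 0"
      using quad[of "- (?a + 1) / (2 * ?b)"] by (cases "?b = 0") (auto simp: field_simps)
    then show ?thesis using True by simp
  next
    case False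
    then have "0 < ?c" using ac by simp
    \<comment> \<open>the value of the polynomial at its minimum\<close>
    have "0 \<le> ?a - ?b\<^sup>2 / ?c"
      using quad[of "- ?b / ?c"] False by (simp add: field_simps power2_eq_square)
    then show ?thesis using \<open>0 < ?c\<close> by (simp add: field_simps)
  qed
  then have "?b\<^sup>2 \<le> (l2_norm M X * l2_norm M Y)\<^sup>2"
    by (simp add: power_mult_distrib l2_norm_square)
  then show ?thesis
    by (simp add: abs_le_square_iff[symmetric] l2_norm_nonneg)
qed

lemma orthogonal_perturbation:
  assumes E: "square_integrable M E" and I: "square_integrable M I" and orth: "l2_inner M E I = 0"
  shows "l2_norm M E \<le> l2_norm M (\<lambda>x. E x + I x)"
proof (rule power2_le_imp_le[OF _ l2_norm_nonneg])
  have "(l2_norm M (\<lambda>x. E x + I x))\<^sup>2 = (l2_norm M E)\<^sup>2 + 2 * l2_inner M E I + (l2_norm M I)\<^sup>2"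
    using E I
    by (simp add: l2_norm_square l2_inner_add_left l2_inner_add_right square_integrable_add
        l2_inner_commute[of M I E])
  then show "(l2_norm M E)\<^sup>2 \<le> (l2_norm M (\<lambda>x. E x + I x))\<^sup>2" using orth by simp
qed


section \<open>Integrals over the time interval\<close>

abbreviation clock :: "real \<Rightarrow> real measure" where
  "clock T \<equiv> restrict_space lborel {0..T}"

lemma space_clock: "space (clock T) = {0..T}"
  by (simp add: space_restrict_space)

lemma finite_measure_clock: "finite_measure (clock T)"
  by (rule finite_measureI)
    (simp add: emeasure_restrict_space space_clock emeasure_lborel_Icc_eq)

lemma measurable_clock_ident: "(\<lambda>s. s) \<in> borel_measurable (clock T)"
  by (rule measurable_restrict_space1) simp

lemma set_integral_clock:
  fixes h :: "real \<Rightarrow> 'b::euclidean_space"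
  assumes "{a..b} \<subseteq> {0..T}"
  shows "(LINT s:{a..b}|clock T. h s) = (LINT s:{a..b}|lborel. h s)"
proof -
  have "(LINT s:{a..b}|clock T. h s) = (LINT s|lborel. indicator {0..T} s *\<^sub>R indicator {a..b} s *\<^sub>R h s)"
    by (simp add: set_lebesgue_integral_def integral_restrict_space)
  also have "\<dots> = (LINT s:{a..b}|lborel. h s)"
    unfolding set_lebesgue_integral_def
    by (intro Bochner_Integration.integral_cong refl) (use assms in \<open>auto simp: indicator_def\<close>)
  finally show ?thesis .
qed

lemma integrable_clock_indicator:
  fixes h :: "real \<Rightarrow> 'b::euclidean_space"
  assumes "integrable (clock T) h"
  shows "integrable (clock T) (\<lambda>s. indicator {a..b} s *\<^sub>R h s)"
  supply measurable_clock_ident [measurable]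
  by (rule Bochner_Integration.integrable_bound[OF assms])
    (use assms in \<open>auto simp: indicator_def\<close>)

text \<open>
  The two intervals overlap in \<open>b\<close>, a null set.
\<close>

lemma set_integral_clock_split:
  fixes h :: "real \<Rightarrow> real"
  assumes "integrable (clock T) h" "a \<le> b" "b \<le> c"
  shows "(LINT s:{a..c}|clock T. h s) = (LINT s:{a..b}|clock T. h s) + (LINT s:{b..c}|clock T. h s)"
proof -
  note measurable_clock_ident [measurable]
  have "(LINT s:{a..c}|clock T. h s)
    = (LINT s|clock T. indicator {a..b} s *\<^sub>R h s + indicator {b..c} s *\<^sub>R h s)"
    unfolding set_lebesgue_integral_def
  proof (rule integral_cong_AE)
    have "AE s in clock T. s \<noteq> b"
      using AE_lborel_singleton[of b] by (auto simp: AE_restrict_space_iff)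
    then show "AE s in clock T. indicator {a..c} s *\<^sub>R h s
      = indicator {a..b} s *\<^sub>R h s + indicator {b..c} s *\<^sub>R h s"
      by eventually_elim (use assms in \<open>auto simp: indicator_def\<close>)
  qed (use assms(1) in simp_all)
  then show ?thesis
    using integrable_clock_indicator[OF assms(1), of a b] integrable_clock_indicator[OF assms(1), of b c]
    by (simp add: set_lebesgue_integral_def)
qed

lemma set_integral_clock_mono:
  fixes h k :: "real \<Rightarrow> real"
  assumes "integrable (clock T) h" "integrable (clock T) k"
    "\<And>s. s \<in> {a..b} \<Longrightarrow> s \<in> {0..T} \<Longrightarrow> h s \<le> k s"
  shows "(LINT s:{a..b}|clock T. h s) \<le> (LINT s:{a..b}|clock T. k s)"
  unfolding set_lebesgue_integral_def
  using assms
  by (intro integral_mono integrable_clock_indicator) (auto simp: indicator_def space_clock)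

lemma set_integral_clock_add:
  fixes h k :: "real \<Rightarrow> real"
  assumes "integrable (clock T) h" "integrable (clock T) k"
  shows "(LINT s:{a..b}|clock T. h s + k s) = (LINT s:{a..b}|clock T. h s) + (LINT s:{a..b}|clock T. k s)"
  unfolding set_lebesgue_integral_def
  using integrable_clock_indicator[OF assms(1)] integrable_clock_indicator[OF assms(2)]
  by (simp add: distrib_left)

lemma set_integral_clock_diff:
  fixes h k :: "real \<Rightarrow> real"
  assumes "integrable (clock T) h" "integrable (clock T) k"
  shows "(LINT s:{a..b}|clock T. h s - k s) = (LINT s:{a..b}|clock T. h s) - (LINT s:{a..b}|clock T. k s)"
  unfolding set_lebesgue_integral_def
  using integrable_clock_indicator[OF assms(1)] integrable_clock_indicator[OF assms(2)]
  by (simp add: right_diff_distrib)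

lemma set_integral_clock_derivative:
  fixes F f :: "real \<Rightarrow> real"
  assumes "0 \<le> a" "a \<le> b" "b \<le> T" "\<And>x. (F has_real_derivative f x) (at x)" "\<And>x. isCont f x"
  shows "(LINT s:{a..b}|clock T. f s) = F b - F a"
proof -
  have "(LINT s:{a..b}|clock T. f s) = (LINT s:{a..b}|lborel. f s)"
    using assms by (intro set_integral_clock) auto
  also have "\<dots> = (LINT s|lborel. f s * indicator {a..b} s)"
    by (simp add: set_lebesgue_integral_def mult.commute)
  also have "\<dots> = F b - F a"
    using assms by (intro integral_FTC_Icc_real) auto
  finally show ?thesis .
qed

lemma set_integral_clock_const:
  fixes k :: real
  assumes "0 \<le> a" "a \<le> b" "b \<le> T"
  shows "(LINT s:{a..b}|clock T. k) = (b - a) * k"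
proof -
  have "((\<lambda>x. x * k) has_real_derivative k) (at x)" for x
    by (auto intro!: derivative_eq_intros)
  from set_integral_clock_derivative[OF assms this] show ?thesis
    by (simp add: left_diff_distrib)
qed

lemma integrable_clock_continuous:
  fixes f :: "real \<Rightarrow> real"
  assumes "continuous_on {0..T} f"
  shows "integrable (clock T) f"
  using borel_integrable_atLeastAtMost'[OF assms]
  by (simp add: integrable_restrict_space set_integrable_def)

lemma set_integral_lborel_point:
  fixes h :: "real \<Rightarrow> 'b::euclidean_space"
  shows "(LINT s:{a..a}|lborel. h s) = 0"
  unfolding set_lebesgue_integral_def
  by (rule integral_eq_zero_AE) (use AE_lborel_singleton[of a] in eventually_elim, simp)


section \<open>Gronwall inequalities\<close>

text \<open>
  The supremum \<open>m\<close> of $u/\phi$ satisfies $m \le A + m/2$, because the weight $\phi$ absorbs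
  half of the integral term.  The argument is made for functions \<open>u\<close> that are integrable but of
  unknown continuity, such as $t \mapsto \|W^x_t - W^y_t\|^2$.  Leaving the intervals of integration
  free covers both directions of time.
\<close>

lemma gronwall_weighted:
  fixes u :: "real \<Rightarrow> real"
  assumes u: "integrable (clock T) u" and u0: "\<And>s. s \<in> {0..T} \<Longrightarrow> 0 \<le> u s"
    and A: "0 \<le> A" and K: "0 \<le> K"
    and ineq: "\<And>t. t \<in> {0..T} \<Longrightarrow> u t \<le> A + K * (LINT s:{a t..b t}|clock T. u s)"
    and \<phi>: "integrable (clock T) \<phi>" "\<And>t. 1 \<le> \<phi> t"
    and w: "\<And>t. t \<in> {0..T} \<Longrightarrow> 2 * K * (LINT s:{a t..b t}|clock T. \<phi> s) \<le> \<phi> t"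
    and t: "t \<in> {0..T}"
  shows "u t \<le> 2 * A * \<phi> t"
proof -
  define m where "m = (SUP s\<in>{0..T}. u s / \<phi> s)"
  have \<phi>0: "0 < \<phi> s" for s using \<phi>(2)[of s] by linarith
  have "u s / \<phi> s \<le> A + K * (LINT r|clock T. u r)" if s: "s \<in> {0..T}" for s
  proof -
    have "u s / \<phi> s \<le> u s"
      using u0[OF s] \<phi>(2)[of s] by (simp add: divide_le_eq mult_le_cancel_left1 \<phi>0)
    also have "\<dots> \<le> A + K * (LINT r:{a s..b s}|clock T. u r)" by (rule ineq[OF s])
    also have "(LINT r:{a s..b s}|clock T. u r) \<le> (LINT r|clock T. u r)"
      unfolding set_lebesgue_integral_def
      using u u0 by (intro integral_mono integrable_clock_indicator) (auto simp: indicator_def space_clock)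
    finally show ?thesis using K by (simp add: mult_left_mono)
  qed
  then have bdd: "bdd_above ((\<lambda>s. u s / \<phi> s) ` {0..T})"
    by (rule bdd_aboveI2)
  have le_m: "u s \<le> m * \<phi> s" if "s \<in> {0..T}" for s
    using cSUP_upper[OF that bdd] \<phi>0[of s] by (simp add: m_def divide_le_eq)
  have "0 \<le> u t / \<phi> t" using u0[OF t] \<phi>0[of t] by simp
  also have "\<dots> \<le> m" unfolding m_def by (rule cSUP_upper[OF t bdd])
  finally have m0: "0 \<le> m" .
  have "u s / \<phi> s \<le> A + m / 2" if s: "s \<in> {0..T}" for s
  proof -
    have "(LINT r:{a s..b s}|clock T. u r) \<le> (LINT r:{a s..b s}|clock T. m * \<phi> r)"
      using le_m u \<phi>(1) by (intro set_integral_clock_mono) auto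
    then have "K * (LINT r:{a s..b s}|clock T. u r) \<le> K * (m * (LINT r:{a s..b s}|clock T. \<phi> r))"
      using K by (intro mult_left_mono) auto
    also have "\<dots> = m / 2 * (2 * K * (LINT r:{a s..b s}|clock T. \<phi> r))" by simp
    also have "\<dots> \<le> m / 2 * \<phi> s" using m0 by (intro mult_left_mono w[OF s]) auto
    finally have "u s \<le> A + m / 2 * \<phi> s" using ineq[OF s] by linarith
    moreover have "A * 1 \<le> A * \<phi> s" using \<phi>(2)[of s] A by (intro mult_left_mono)
    ultimately have "u s \<le> (A + m / 2) * \<phi> s" by (simp add: algebra_simps)
    then show ?thesis using \<phi>0[of s] by (simp add: divide_le_eq)
  qed
  then have "m \<le> A + m / 2"
    unfolding m_def using t by (intro cSUP_least) auto
  then have "m * \<phi> t \<le> 2 * A * \<phi> t" using \<phi>0[of t] by (intro mult_right_mono) auto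
  then show ?thesis using le_m[OF t] by linarith
qed

lemma gronwall_forward:
  fixes u :: "real \<Rightarrow> real"
  assumes u: "integrable (clock T) u" and u0: "\<And>s. s \<in> {0..T} \<Longrightarrow> 0 \<le> u s"
    and A: "0 \<le> A" and K: "0 \<le> K"
    and ineq: "\<And>t. t \<in> {0..T} \<Longrightarrow> u t \<le> A + K * (LINT s:{0..t}|clock T. u s)"
    and t: "t \<in> {0..T}"
  shows "u t \<le> 2 * A * exp (2 * K * T)"
proof -
  \<comment> \<open>the absolute value only serves to make the weight at least 1 everywhere\<close>
  define \<phi> where "\<phi> s = exp (2 * K * \<bar>s\<bar>)" for s
  have "2 * K * (LINT s:{0..r}|clock T. \<phi> s) \<le> \<phi> r" if r: "r \<in> {0..T}" for r
  proof -
    have "2 * K * (LINT s:{0..r}|clock T. \<phi> s) = (LINT s:{0..r}|clock T. 2 * K * \<phi> s)"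
      by simp
    also have "\<dots> = (LINT s:{0..r}|clock T. 2 * K * exp (2 * K * s))"
      unfolding set_lebesgue_integral_def
      by (intro Bochner_Integration.integral_cong refl) (auto simp: indicator_def \<phi>_def)
    also have "\<dots> = exp (2 * K * r) - exp (2 * K * 0)"
      using r by (intro set_integral_clock_derivative)
        (auto intro!: derivative_eq_intros continuous_intros)
    also have "\<dots> \<le> \<phi> r" using r by (simp add: \<phi>_def)
    finally show ?thesis .
  qed
  then have "u t \<le> 2 * A * \<phi> t"
    by (intro gronwall_weighted[OF u u0 A K ineq _ _ _ t])
      (auto simp: \<phi>_def K intro!: integrable_clock_continuous continuous_intros)
  also have "\<dots> \<le> 2 * A * exp (2 * K * T)"
    using A K t by (intro mult_left_mono) (auto simp: \<phi>_def intro!: mult_left_mono)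
  finally show ?thesis .
qed

lemma gronwall_backward:
  fixes u :: "real \<Rightarrow> real"
  assumes u: "integrable (clock T) u" and u0: "\<And>s. s \<in> {0..T} \<Longrightarrow> 0 \<le> u s"
    and A: "0 \<le> A" and K: "0 \<le> K"
    and ineq: "\<And>t. t \<in> {0..T} \<Longrightarrow> u t \<le> A + K * (LINT s:{t..T}|clock T. u s)"
    and t: "t \<in> {0..T}"
  shows "u t \<le> 2 * A * exp (2 * K * T)"
proof -
  define \<phi> where "\<phi> s = exp (2 * K * \<bar>T - s\<bar>)" for s
  have "2 * K * (LINT s:{r..T}|clock T. \<phi> s) \<le> \<phi> r" if r: "r \<in> {0..T}" for r
  proof -
    have "2 * K * (LINT s:{r..T}|clock T. \<phi> s) = (LINT s:{r..T}|clock T. 2 * K * \<phi> s)"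
      by simp
    also have "\<dots> = (LINT s:{r..T}|clock T. 2 * K * exp (2 * K * (T - s)))"
      unfolding set_lebesgue_integral_def
      by (intro Bochner_Integration.integral_cong refl) (auto simp: indicator_def \<phi>_def)
    also have "\<dots> = - exp (2 * K * (T - T)) - (- exp (2 * K * (T - r)))"
      using r by (intro set_integral_clock_derivative)
        (auto intro!: derivative_eq_intros continuous_intros)
    also have "\<dots> \<le> \<phi> r" using r by (simp add: \<phi>_def)
    finally show ?thesis .
  qed
  then have "u t \<le> 2 * A * \<phi> t"
    by (intro gronwall_weighted[OF u u0 A K ineq _ _ _ t])
      (auto simp: \<phi>_def K intro!: integrable_clock_continuous continuous_intros)
  also have "\<dots> \<le> 2 * A * exp (2 * K * T)"
    using A K t by (intro mult_left_mono) (auto simp: \<phi>_def intro!: mult_left_mono)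
  finally show ?thesis .
qed


section \<open>Square integrable processes\<close>

lemma square_integrable_process_diff:
  assumes "square_integrable N (case_prod X)" "square_integrable N (case_prod Y)"
  shows "square_integrable N (case_prod (\<lambda>s x. X s x - Y s x))"
  using square_integrable_diff[OF assms] by (simp add: case_prod_unfold)

lemma square_integrable_process_minus:
  assumes "square_integrable N (case_prod X)"
  shows "square_integrable N (case_prod (\<lambda>s x. - X s x))"
  using square_integrable_minus[OF assms] by (simp add: case_prod_unfold)

lemma integrable_comp_fst:
  fixes f :: "'a \<Rightarrow> 'c::euclidean_space"
  assumes "sigma_finite_measure M" "finite_measure N" "integrable M f"
  shows "integrable (M \<Otimes>\<^sub>M N) (\<lambda>p. f (fst p))"
proof -
  interpret M: sigma_finite_measure M by fact
  interpret N: finite_measure N by fact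
  interpret pair_sigma_finite M N ..
  show ?thesis
    by (rule Fubini_integrable) (use assms(3) in auto)
qed

lemma integrable_comp_snd:
  fixes f :: "'a \<Rightarrow> 'c::euclidean_space"
  assumes "sigma_finite_measure M" "finite_measure N" "integrable M f"
  shows "integrable (N \<Otimes>\<^sub>M M) (\<lambda>p. f (snd p))"
proof -
  interpret M: sigma_finite_measure M by fact
  interpret N: finite_measure N by fact
  interpret pair_sigma_finite N M ..
  show ?thesis
    using integrable_comp_fst[OF assms]
    by (subst integrable_product_swap_iff[symmetric]) (simp add: case_prod_unfold)
qed

lemma integrable_l2_inner_fixed:
  fixes f :: "real \<Rightarrow> 'a \<Rightarrow> 'b::euclidean_space"
  assumes N: "finite_measure N" and M: "finite_measure M"
    and f: "square_integrable (N \<Otimes>\<^sub>M M) (case_prod f)" and V: "square_integrable M V"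
  shows "integrable (N \<Otimes>\<^sub>M M) (\<lambda>(s, x). f s x \<bullet> V x)"
proof -
  interpret N: finite_measure N by fact
  interpret M: finite_measure M by fact
  have "square_integrable (N \<Otimes>\<^sub>M M) (\<lambda>p. V (snd p))"
    using V integrable_comp_snd[OF M.sigma_finite_measure_axioms N, of "\<lambda>x. (norm (V x))\<^sup>2"]
    by (auto simp: square_integrable_def)
  from integrable_inner[OF f this] show ?thesis
    by (simp add: case_prod_unfold)
qed

text \<open>
  A pairing with a fixed vector commutes with a Bochner integral.  Here the integral is formed
  pathwise, and it exists for almost every path only.
\<close>

lemma l2_inner_integral:
  fixes f :: "real \<Rightarrow> 'a \<Rightarrow> 'b::euclidean_space"
  assumes N: "finite_measure N" and M: "finite_measure M"
    and f: "square_integrable (N \<Otimes>\<^sub>M M) (case_prod f)" and V: "square_integrable M V"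
  shows "integrable N (\<lambda>s. l2_inner M (f s) V)"
    and "l2_inner M (\<lambda>x. LINT s|N. f s x) V = (LINT s|N. l2_inner M (f s) V)"
proof -
  interpret N: finite_measure N by fact
  interpret M: finite_measure M by fact
  interpret pair_sigma_finite N M ..
  interpret NM: finite_measure "N \<Otimes>\<^sub>M M"
    using M N by (rule finite_measure_pair_measure)
  note fV = integrable_l2_inner_fixed[OF assms]
  show "integrable N (\<lambda>s. l2_inner M (f s) V)"
    using integrable_fst'[OF fV] by (simp add: l2_inner_def)
  have f1: "integrable (N \<Otimes>\<^sub>M M) (case_prod f)"
    by (rule square_integrable_integrable[OF _ f]) (rule NM.finite_measure_axioms)
  have [measurable]: "case_prod f \<in> borel_measurable (N \<Otimes>\<^sub>M M)" "V \<in> borel_measurable M"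
    using f V by (auto simp: square_integrable_def)
  have "l2_inner M (\<lambda>x. LINT s|N. f s x) V = (LINT x|M. LINT s|N. f s x \<bullet> V x)"
    unfolding l2_inner_def
  proof (rule integral_cong_AE)
    show "AE x in M. (LINT s|N. f s x) \<bullet> V x = (LINT s|N. f s x \<bullet> V x)"
      using AE_integrable_snd[OF f1]
      by eventually_elim simp
  qed measurable
  also have "\<dots> = (LINT s|N. l2_inner M (f s) V)"
    unfolding l2_inner_def by (rule Fubini_integral[OF fV])
  finally show "l2_inner M (\<lambda>x. LINT s|N. f s x) V = (LINT s|N. l2_inner M (f s) V)" .
qed

text \<open>
  The integrable kernel to which Fubini's theorem is applied in the product rule.
\<close>

lemma integrable_l2_kernel:
  fixes p q :: "real \<Rightarrow> 'a \<Rightarrow> 'b::euclidean_space"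
  assumes N: "finite_measure N" and M: "finite_measure M"
    and p: "square_integrable (N \<Otimes>\<^sub>M M) (case_prod p)" "\<And>s. s \<in> space N \<Longrightarrow> square_integrable M (p s)"
    and q: "square_integrable (N \<Otimes>\<^sub>M M) (case_prod q)" "\<And>s. s \<in> space N \<Longrightarrow> square_integrable M (q s)"
  shows "integrable (N \<Otimes>\<^sub>M N) (\<lambda>(s, r). l2_inner M (p s) (q r))"
proof -
  interpret N: finite_measure N by fact
  interpret M: finite_measure M by fact
  interpret pair_sigma_finite N M ..
  have sq: "integrable N (\<lambda>s. LINT x|M. (norm (f s x))\<^sup>2)"
    if "square_integrable (N \<Otimes>\<^sub>M M) (case_prod f)" for f :: "real \<Rightarrow> 'a \<Rightarrow> 'b"
    using integrable_fst'[of "\<lambda>z. (norm (case_prod f z))\<^sup>2"] that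
    by (simp add: square_integrable_def)
  let ?p = "\<lambda>s. LINT x|M. (norm (p s x))\<^sup>2" and ?q = "\<lambda>s. LINT x|M. (norm (q s x))\<^sup>2"
  have [measurable]: "case_prod p \<in> borel_measurable (N \<Otimes>\<^sub>M M)" "case_prod q \<in> borel_measurable (N \<Otimes>\<^sub>M M)"
    using p(1) q(1) by (auto simp: square_integrable_def)
  show ?thesis
  proof (rule Bochner_Integration.integrable_bound)
    show "integrable (N \<Otimes>\<^sub>M N) (\<lambda>z. ?p (fst z) + ?q (snd z))"
      using integrable_comp_fst[OF N.sigma_finite_measure_axioms N sq[OF p(1)]]
        integrable_comp_snd[OF N.sigma_finite_measure_axioms N sq[OF q(1)]]
      by (rule Bochner_Integration.integrable_add)
    show "AE z in N \<Otimes>\<^sub>M N. norm (case z of (s, r) \<Rightarrow> l2_inner M (p s) (q r)) \<le> norm (?p (fst z) + ?q (snd z))"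
    proof (rule AE_I2)
      fix z assume z: "z \<in> space (N \<Otimes>\<^sub>M N)"
      obtain s r where [simp]: "z = (s, r)" by (cases z)
      have sr: "square_integrable M (p s)" "square_integrable M (q r)"
        using z p(2) q(2) by (auto simp: space_pair_measure)
      have "\<bar>l2_inner M (p s) (q r)\<bar> \<le> (LINT x|M. (norm (p s x))\<^sup>2 + (norm (q r x))\<^sup>2)"
        unfolding l2_inner_def
        by (rule order_trans[OF integral_abs_bound], rule integral_mono)
          (use sr abs_inner_le_squares integrable_inner[OF sr] in \<open>auto simp: square_integrable_def\<close>)
      also have "\<dots> = ?p s + ?q r"
        using sr by (auto simp: square_integrable_def)
      finally show "norm (case z of (s, r) \<Rightarrow> l2_inner M (p s) (q r)) \<le> norm (?p (fst z) + ?q (snd z))"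
        by simp
    qed
    show "(\<lambda>(s, r). l2_inner M (p s) (q r)) \<in> borel_measurable (N \<Otimes>\<^sub>M N)"
      unfolding l2_inner_def by measurable
  qed
qed

lemma integrable_l2_norm_square:
  fixes X :: "real \<Rightarrow> 'a \<Rightarrow> 'b::euclidean_space"
  assumes N: "finite_measure N" and M: "finite_measure M"
    and X: "square_integrable (N \<Otimes>\<^sub>M M) (case_prod X)"
  shows "integrable N (\<lambda>s. (l2_norm M (X s))\<^sup>2)"
proof -
  interpret N: finite_measure N by fact
  interpret M: finite_measure M by fact
  interpret pair_sigma_finite N M ..
  show ?thesis
    using integrable_fst'[OF square_integrableD(2)[OF X]]
    by (simp add: l2_norm_def Bochner_Integration.integral_nonneg)
qed

lemma AE_set_integrable_lborel:
  fixes p :: "real \<Rightarrow> 'a \<Rightarrow> 'b::euclidean_space"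
  assumes M: "finite_measure M" and p: "square_integrable (clock T \<Otimes>\<^sub>M M) (case_prod p)"
    and ab: "{a..b} \<subseteq> {0..T}"
  shows "AE x in M. set_integrable lborel {a..b} (\<lambda>s. p s x)"
proof -
  interpret M: finite_measure M by fact
  interpret N: finite_measure "clock T" by (rule finite_measure_clock)
  interpret pair_sigma_finite "clock T" M ..
  have "integrable (clock T \<Otimes>\<^sub>M M) (case_prod p)"
    by (rule square_integrable_integrable[OF finite_measure_pair_measure[OF M finite_measure_clock] p])
  from AE_integrable_snd[OF this] show ?thesis
  proof eventually_elim
    case (elim x)
    then have "set_integrable lborel {0..T} (\<lambda>s. p s x)"
      by (simp add: set_integrable_def integrable_restrict_space)
    then show ?case by (rule set_integrable_subset) (use ab in auto)
  qed
qed

lemma l2_inner_interval_integral: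
  fixes p :: "real \<Rightarrow> 'a \<Rightarrow> 'b::euclidean_space"
  assumes M: "finite_measure M" and p: "square_integrable (clock T \<Otimes>\<^sub>M M) (case_prod p)"
    and V: "square_integrable M V" and ab: "{a..b} \<subseteq> {0..T}"
  shows "(\<lambda>x. LINT s:{a..b}|lborel. p s x) \<in> borel_measurable M"
    and "l2_inner M (\<lambda>x. LINT s:{a..b}|lborel. p s x) V = (LINT s:{a..b}|clock T. l2_inner M (p s) V)"
proof -
  interpret M: finite_measure M by fact
  interpret N: finite_measure "clock T" by (rule finite_measure_clock)
  have [measurable]: "case_prod p \<in> borel_measurable (clock T \<Otimes>\<^sub>M M)"
    using p by (simp add: square_integrable_def)
  note measurable_clock_ident [measurable]
  let ?p = "\<lambda>s x. indicator {a..b} s *\<^sub>R p s x"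
  have [measurable]: "(\<lambda>z. ?p (fst z) (snd z)) \<in> borel_measurable (clock T \<Otimes>\<^sub>M M)"
    by measurable
  have sq: "square_integrable (clock T \<Otimes>\<^sub>M M) (case_prod ?p)"
    by (rule square_integrable_bound[OF _ square_integrableD(2)[OF p]])
      (auto simp: case_prod_unfold indicator_def)
  have eq: "(LINT s:{a..b}|lborel. p s x) = (LINT s|clock T. ?p s x)" for x
    using set_integral_clock[OF ab, of "\<lambda>s. p s x"] by (simp add: set_lebesgue_integral_def)
  show "(\<lambda>x. LINT s:{a..b}|lborel. p s x) \<in> borel_measurable M"
    unfolding eq by measurable
  show "l2_inner M (\<lambda>x. LINT s:{a..b}|lborel. p s x) V = (LINT s:{a..b}|clock T. l2_inner M (p s) V)"
    unfolding eq l2_inner_integral(2)[OF finite_measure_clock M sq V]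
    by (simp add: set_lebesgue_integral_def l2_inner_def)
qed


section \<open>Absolutely continuous curves in $L^2$\<close>

text \<open>
  The curve $P$ in $L^2$ is a primitive of $p$.  The relation is required after pairing with each
  vector: this turns all manipulations into manipulations of real integrals, and it disregards the
  null sets, depending on time, on which a pathwise equation may fail.
\<close>

definition has_l2_derivative ::
  "'a measure \<Rightarrow> real \<Rightarrow> (real \<Rightarrow> 'a \<Rightarrow> 'b::euclidean_space) \<Rightarrow> (real \<Rightarrow> 'a \<Rightarrow> 'b) \<Rightarrow> bool" where
  "has_l2_derivative M T P p \<longleftrightarrow>
     square_integrable (clock T \<Otimes>\<^sub>M M) (case_prod p) \<and>
     (\<forall>s\<in>{0..T}. square_integrable M (p s) \<and> square_integrable M (P s)) \<and>
     (\<forall>s t V. 0 \<le> s \<and> s \<le> t \<and> t \<le> T \<and> square_integrable M V \<longrightarrow>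
        l2_inner M (P t) V - l2_inner M (P s) V = (LINT r:{s..t}|clock T. l2_inner M (p r) V))"

lemma has_l2_derivativeD:
  assumes "has_l2_derivative M T P p"
  shows "square_integrable (clock T \<Otimes>\<^sub>M M) (case_prod p)"
    "s \<in> {0..T} \<Longrightarrow> square_integrable M (p s)" "s \<in> {0..T} \<Longrightarrow> square_integrable M (P s)"
    "0 \<le> s \<Longrightarrow> s \<le> t \<Longrightarrow> t \<le> T \<Longrightarrow> square_integrable M V \<Longrightarrow>
       l2_inner M (P t) V - l2_inner M (P s) V = (LINT r:{s..t}|clock T. l2_inner M (p r) V)"
  using assms by (auto simp: has_l2_derivative_def)

lemma has_l2_derivative_forward:
  fixes p :: "real \<Rightarrow> 'a \<Rightarrow> 'b::euclidean_space"
  assumes M: "finite_measure M" and p: "square_integrable (clock T \<Otimes>\<^sub>M M) (case_prod p)"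
    and ps: "\<And>s. s \<in> {0..T} \<Longrightarrow> square_integrable M (p s)"
    and P: "\<And>s. s \<in> {0..T} \<Longrightarrow> square_integrable M (P s)" and R: "square_integrable M R"
    and eq: "\<And>t. t \<in> {0..T} \<Longrightarrow> AE x in M. P t x = R x + (LINT s:{0..t}|lborel. p s x)"
  shows "has_l2_derivative M T P p"
  unfolding has_l2_derivative_def
proof (intro conjI ballI allI impI p)
  fix s t and V :: "'a \<Rightarrow> 'b" assume st: "0 \<le> s \<and> s \<le> t \<and> t \<le> T \<and> square_integrable M V"
  then have V: "square_integrable M V" by simp
  have weak: "l2_inner M (P t) V = l2_inner M R V + (LINT r:{0..t}|clock T. l2_inner M (p r) V)"
    if t: "t \<in> {0..T}" for t
  proof -
    have sub: "{0..t} \<subseteq> {0..T}" using t by auto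
    note I = l2_inner_interval_integral[OF M p V sub]
    have "l2_inner M (\<lambda>x. P t x - R x) V = (LINT r:{0..t}|clock T. l2_inner M (p r) V)"
      unfolding I(2)[symmetric]
      by (rule l2_inner_cong_AE)
        (use eq[OF t] I(1) P[OF t] R V in \<open>auto simp: square_integrable_def\<close>)
    then show ?thesis
      by (simp add: l2_inner_diff_left[OF P[OF t] R V])
  qed
  show "l2_inner M (P t) V - l2_inner M (P s) V = (LINT r:{s..t}|clock T. l2_inner M (p r) V)"
    using weak[of t] weak[of s] st
      set_integral_clock_split[OF l2_inner_integral(1)[OF finite_measure_clock M p V], of 0 s t]
    by auto
qed (use ps P in auto)

lemma has_l2_derivative_backward:
  fixes p :: "real \<Rightarrow> 'a \<Rightarrow> 'b::euclidean_space"
  assumes M: "finite_measure M" and p: "square_integrable (clock T \<Otimes>\<^sub>M M) (case_prod p)"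
    and ps: "\<And>s. s \<in> {0..T} \<Longrightarrow> square_integrable M (p s)"
    and P: "\<And>s. s \<in> {0..T} \<Longrightarrow> square_integrable M (P s)" and R: "square_integrable M R"
    and eq: "\<And>t. t \<in> {0..T} \<Longrightarrow> AE x in M. P t x = R x - (LINT s:{t..T}|lborel. p s x)"
  shows "has_l2_derivative M T P p"
  unfolding has_l2_derivative_def
proof (intro conjI ballI allI impI p)
  fix s t and V :: "'a \<Rightarrow> 'b" assume st: "0 \<le> s \<and> s \<le> t \<and> t \<le> T \<and> square_integrable M V"
  then have V: "square_integrable M V" by simp
  have weak: "l2_inner M (P t) V = l2_inner M R V - (LINT r:{t..T}|clock T. l2_inner M (p r) V)"
    if t: "t \<in> {0..T}" for t
  proof -
    have sub: "{t..T} \<subseteq> {0..T}" using t by auto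
    note I = l2_inner_interval_integral[OF M p V sub]
    have "l2_inner M (\<lambda>x. R x - P t x) V = (LINT r:{t..T}|clock T. l2_inner M (p r) V)"
      unfolding I(2)[symmetric]
      by (rule l2_inner_cong_AE)
        (use eq[OF t] I(1) P[OF t] R V in \<open>auto simp: square_integrable_def\<close>)
    then show ?thesis
      by (simp add: l2_inner_diff_left[OF R P[OF t] V])
  qed
  show "l2_inner M (P t) V - l2_inner M (P s) V = (LINT r:{s..t}|clock T. l2_inner M (p r) V)"
    using weak[of t] weak[of s] st
      set_integral_clock_split[OF l2_inner_integral(1)[OF finite_measure_clock M p V], of s t T]
    by auto
qed (use ps P in auto)

text \<open>
  Both iterated integrals are over $\{(s,r) \mid a \le s \le r \le b\}$.
\<close>

lemma triangle_integral_swap: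
  fixes h :: "real \<Rightarrow> real \<Rightarrow> real"
  assumes h: "integrable (clock T \<Otimes>\<^sub>M clock T) (case_prod h)"
  shows "(LINT s:{a..b}|clock T. LINT r:{s..b}|clock T. h s r)
    = (LINT r:{a..b}|clock T. LINT s:{a..r}|clock T. h s r)"
    and "integrable (clock T) (\<lambda>s. LINT r:{s..b}|clock T. h s r)"
    and "integrable (clock T) (\<lambda>r. LINT s:{a..r}|clock T. h s r)"
proof -
  interpret N: finite_measure "clock T" by (rule finite_measure_clock)
  interpret pair_sigma_finite "clock T" "clock T" ..
  note measurable_clock_ident [measurable]
  have [measurable]: "case_prod h \<in> borel_measurable (clock T \<Otimes>\<^sub>M clock T)"
    using h by auto
  have cut: "integrable (clock T \<Otimes>\<^sub>M clock T) (\<lambda>(s, r). of_bool (P s r) * h s r)"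
    if [measurable]: "Measurable.pred (clock T \<Otimes>\<^sub>M clock T) (case_prod P)" for P
  proof (rule Bochner_Integration.integrable_bound[OF h])
    have [measurable]: "Measurable.pred (clock T \<Otimes>\<^sub>M clock T) (\<lambda>z. P (fst z) (snd z))"
      using that by (simp add: case_prod_unfold)
    have "(\<lambda>z. (if P (fst z) (snd z) then 1 else 0) * h (fst z) (snd z)) \<in> borel_measurable (clock T \<Otimes>\<^sub>M clock T)"
      by measurable
    then show "(\<lambda>(s, r). of_bool (P s r) * h s r) \<in> borel_measurable (clock T \<Otimes>\<^sub>M clock T)"
      by (simp add: case_prod_unfold of_bool_def)
  qed auto
  have tri: "integrable (clock T \<Otimes>\<^sub>M clock T) (\<lambda>(s, r). of_bool (a \<le> s \<and> s \<le> r \<and> r \<le> b) * h s r)"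
    by (rule cut) measurable
  have "(LINT s:{a..b}|clock T. LINT r:{s..b}|clock T. h s r)
    = (LINT s|clock T. LINT r|clock T. of_bool (a \<le> s \<and> s \<le> r \<and> r \<le> b) * h s r)"
    unfolding set_lebesgue_integral_def integral_scaleR_right[symmetric]
    by (intro Bochner_Integration.integral_cong refl) (auto simp: indicator_def)
  also have "\<dots> = (LINT r|clock T. LINT s|clock T. of_bool (a \<le> s \<and> s \<le> r \<and> r \<le> b) * h s r)"
    by (rule Fubini_integral[OF tri, symmetric])
  also have "\<dots> = (LINT r:{a..b}|clock T. LINT s:{a..r}|clock T. h s r)"
    unfolding set_lebesgue_integral_def integral_scaleR_right[symmetric]
    by (intro Bochner_Integration.integral_cong refl) (auto simp: indicator_def)
  finally show "(LINT s:{a..b}|clock T. LINT r:{s..b}|clock T. h s r)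
    = (LINT r:{a..b}|clock T. LINT s:{a..r}|clock T. h s r)" .
  have "integrable (clock T \<Otimes>\<^sub>M clock T) (\<lambda>(s, r). of_bool (s \<le> r \<and> r \<le> b) * h s r)"
    by (rule cut) measurable
  from integrable_fst[OF this]
  show "integrable (clock T) (\<lambda>s. LINT r:{s..b}|clock T. h s r)"
    by (rule iffD1[OF Bochner_Integration.integrable_cong, rotated -1])
      (auto simp: set_lebesgue_integral_def indicator_def intro!: Bochner_Integration.integral_cong)
  have "integrable (clock T \<Otimes>\<^sub>M clock T) (\<lambda>(s, r). of_bool (a \<le> s \<and> s \<le> r) * h s r)"
    by (rule cut) measurable
  from integrable_snd[OF this]
  show "integrable (clock T) (\<lambda>r. LINT s:{a..r}|clock T. h s r)"
    by (rule iffD1[OF Bochner_Integration.integrable_cong, rotated -1])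
      (auto simp: set_lebesgue_integral_def indicator_def intro!: Bochner_Integration.integral_cong)
qed

text \<open>
  Expand $\langle P_b,Q_b\rangle - \langle P_a,Q_a\rangle$ as
  $\langle P_b - P_a, Q_b\rangle + \langle P_a, Q_b - Q_a\rangle$.  Replacing the frozen factors
  $Q_b$ and $P_a$ by $Q_s$ and $P_s$ under the integral costs
  $\int_a^b\int_s^b \langle p_s,q_r\rangle\,dr\,ds$ and
  $\int_a^b\int_a^s \langle p_r,q_s\rangle\,dr\,ds$, which are the same integral over a triangle and
  enter with opposite signs.
\<close>

lemma l2_product_rule:
  fixes p q :: "real \<Rightarrow> 'a \<Rightarrow> 'b::euclidean_space"
  assumes M: "finite_measure M" and P: "has_l2_derivative M T P p" and Q: "has_l2_derivative M T Q q"
  shows "integrable (clock T) (\<lambda>s. l2_inner M (p s) (Q s))"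
    and "integrable (clock T) (\<lambda>s. l2_inner M (P s) (q s))"
    and "0 \<le> a \<Longrightarrow> a \<le> b \<Longrightarrow> b \<le> T \<Longrightarrow>
      l2_inner M (P b) (Q b) - l2_inner M (P a) (Q a)
        = (LINT s:{a..b}|clock T. l2_inner M (p s) (Q s)) + (LINT s:{a..b}|clock T. l2_inner M (P s) (q s))"
proof -
  note Pd = has_l2_derivativeD[OF P] and Qd = has_l2_derivativeD[OF Q]
  have h: "integrable (clock T \<Otimes>\<^sub>M clock T) (\<lambda>(s, r). l2_inner M (p s) (q r))"
    using Pd(1,2) Qd(1,2) by (intro integrable_l2_kernel finite_measure_clock M) (auto simp: space_clock)
  have pQ: "l2_inner M (p s) (Q s) = l2_inner M (p s) (Q b) - (LINT r:{s..b}|clock T. l2_inner M (p s) (q r))"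
    if "0 \<le> s" "s \<le> b" "b \<le> T" for s b
    using Qd(4)[of s b "p s"] Pd(2)[of s] that by (simp add: l2_inner_commute[of M "p s"])
  have Pq: "l2_inner M (P s) (q s) = l2_inner M (P a) (q s) + (LINT r:{a..s}|clock T. l2_inner M (p r) (q s))"
    if "0 \<le> a" "a \<le> s" "s \<le> T" for s a
    using Pd(4)[of a s "q s"] Qd(2)[of s] that by simp
  have pV: "integrable (clock T) (\<lambda>s. l2_inner M (p s) V)" if "square_integrable M V" for V
    by (rule l2_inner_integral(1)[OF finite_measure_clock M Pd(1) that])
  have Vq: "integrable (clock T) (\<lambda>s. l2_inner M V (q s))" if "square_integrable M V" for V
    using l2_inner_integral(1)[OF finite_measure_clock M Qd(1) that] by (simp add: l2_inner_commute)
  note tri = triangle_integral_swap[OF h]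
  show int_pQ: "integrable (clock T) (\<lambda>s. l2_inner M (p s) (Q s))"
  proof (cases "0 \<le> T")
    case True
    have "integrable (clock T) (\<lambda>s. l2_inner M (p s) (Q T) - (LINT r:{s..T}|clock T. l2_inner M (p s) (q r)))"
      using True by (intro Bochner_Integration.integrable_diff pV tri(2) Qd(3)) auto
    then show ?thesis
      by (rule iffD1[OF Bochner_Integration.integrable_cong, rotated -1]) (auto simp: space_clock pQ)
  qed (simp add: integrable_restrict_space)
  show int_Pq: "integrable (clock T) (\<lambda>s. l2_inner M (P s) (q s))"
  proof (cases "0 \<le> T")
    case True
    have "integrable (clock T) (\<lambda>s. l2_inner M (P 0) (q s) + (LINT r:{0..s}|clock T. l2_inner M (p r) (q s)))"
      using True by (intro Bochner_Integration.integrable_add Vq tri(3) Pd(3)) auto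
    then show ?thesis
      by (rule iffD1[OF Bochner_Integration.integrable_cong, rotated -1])
        (auto simp: space_clock intro!: Pq[symmetric])
  qed (simp add: integrable_restrict_space)
  assume ab: "0 \<le> a" "a \<le> b" "b \<le> T"
  have Pa: "square_integrable M (P a)" and Qb: "square_integrable M (Q b)"
    and Qa: "square_integrable M (Q a)" and Pb: "square_integrable M (P b)"
    using ab by (auto intro: Pd(3) Qd(3))
  have cong: "(LINT s:{a..b}|clock T. u s) = (LINT s:{a..b}|clock T. v s)"
    if "\<And>s. a \<le> s \<Longrightarrow> s \<le> b \<Longrightarrow> u s = v s" for u v :: "real \<Rightarrow> real"
    unfolding set_lebesgue_integral_def
    by (intro Bochner_Integration.integral_cong refl) (use that in \<open>auto simp: indicator_def\<close>)
  have "(LINT s:{a..b}|clock T. l2_inner M (p s) (Q s))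
      = (LINT s:{a..b}|clock T. l2_inner M (p s) (Q b) - (LINT r:{s..b}|clock T. l2_inner M (p s) (q r)))"
    using ab by (intro cong) (auto intro: pQ)
  also have "\<dots> = (LINT s:{a..b}|clock T. l2_inner M (p s) (Q b))
      - (LINT s:{a..b}|clock T. LINT r:{s..b}|clock T. l2_inner M (p s) (q r))"
    by (intro set_integral_clock_diff pV Qb tri(2))
  finally have 1: "(LINT s:{a..b}|clock T. l2_inner M (p s) (Q s))
      = (l2_inner M (P b) (Q b) - l2_inner M (P a) (Q b))
        - (LINT s:{a..b}|clock T. LINT r:{s..b}|clock T. l2_inner M (p s) (q r))"
    using Pd(4)[OF ab Qb] by simp
  have "(LINT s:{a..b}|clock T. l2_inner M (P s) (q s))
      = (LINT s:{a..b}|clock T. l2_inner M (P a) (q s) + (LINT r:{a..s}|clock T. l2_inner M (p r) (q s)))"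
    using ab by (intro cong) (auto intro: Pq)
  also have "\<dots> = (LINT s:{a..b}|clock T. l2_inner M (P a) (q s))
      + (LINT s:{a..b}|clock T. LINT r:{a..s}|clock T. l2_inner M (p r) (q s))"
    by (intro set_integral_clock_add Vq Pa tri(3))
  finally have 2: "(LINT s:{a..b}|clock T. l2_inner M (P s) (q s))
      = (l2_inner M (P a) (Q b) - l2_inner M (P a) (Q a))
        + (LINT s:{a..b}|clock T. LINT r:{a..s}|clock T. l2_inner M (p r) (q s))"
    using Qd(4)[OF ab Pa] by (simp add: l2_inner_commute[of M "P a"])
  show "l2_inner M (P b) (Q b) - l2_inner M (P a) (Q a)
        = (LINT s:{a..b}|clock T. l2_inner M (p s) (Q s)) + (LINT s:{a..b}|clock T. l2_inner M (P s) (q s))"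
    unfolding 1 2 tri(1) by simp
qed


section \<open>Gaussian increments\<close>

lemma integral_lborel_uminus:
  fixes f :: "'b::euclidean_space \<Rightarrow> real"
  assumes [measurable]: "f \<in> borel_measurable borel"
  shows "(LINT x|lborel. f (- x)) = (LINT x|lborel. f x)"
proof -
  have "(LINT x|lborel. f x) = (LINT x|distr lborel borel uminus. f x)"
    using lborel_affine[of "-1" "0 :: 'b"] by (simp add: density_1)
  also have "\<dots> = (LINT x|lborel. f (- x))"
    by (rule integral_distr) measurable
  finally show ?thesis by simp
qed

text \<open>
  The integrand is odd.
\<close>

lemma product_normal_mean:
  fixes i :: "'n::finite"
  shows "(LINT x|lborel. (\<Prod>j\<in>UNIV. normal_density 0 \<sigma> (x $ j)) * (x :: real ^ 'n) $ i) = 0"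
proof -
  let ?g = "\<lambda>x :: real ^ 'n. (\<Prod>j\<in>UNIV. normal_density 0 \<sigma> (x $ j)) * x $ i"
  have "(LINT x|lborel. ?g (- x)) = - (LINT x|lborel. ?g x)"
    by (simp add: normal_density_def)
  moreover have "(LINT x|lborel. ?g (- x)) = (LINT x|lborel. ?g x)"
    by (rule integral_lborel_uminus) measurable
  ultimately show ?thesis by simp
qed

text \<open>
  The integrand is a product of functions of the single coordinates, so its integral is the product
  of one-dimensional Gaussian integrals.
\<close>

lemma product_normal_second_moment:
  fixes i :: "'n::finite"
  assumes \<sigma>: "0 < \<sigma>"
  shows "integrable lborel (\<lambda>x. (\<Prod>j\<in>UNIV. normal_density 0 \<sigma> (x $ j)) * ((x :: real ^ 'n) $ i)\<^sup>2)"
proof (rule integrableI_nonneg)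
  let ?b = "axis i 1 :: real ^ 'n"
  \<comment> \<open>one factor per basis vector; the factor of the coordinate \<open>i\<close> carries the square\<close>
  define h where "h b y = normal_density 0 \<sigma> y * (if b = ?b then y\<^sup>2 else 1)" for b :: "real ^ 'n" and y
  have h0: "0 \<le> h b y" for b y by (simp add: h_def)
  have Basis: "(Basis :: (real ^ 'n) set) = range (\<lambda>j. axis j 1)"
    by (auto simp: Basis_vec_def)
  have inj: "inj (\<lambda>j. axis j 1 :: real ^ 'n)" by (auto intro: injI simp: axis_eq_axis)
  have "(\<Prod>j\<in>UNIV. normal_density 0 \<sigma> (x $ j)) * (x $ i)\<^sup>2 = (\<Prod>b\<in>Basis. h b (x \<bullet> b))" for x :: "real ^ 'n"
  proof -
    have "(\<Prod>b\<in>Basis. h b (x \<bullet> b)) = (\<Prod>j\<in>UNIV. h (axis j 1) (x $ j))"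
      unfolding Basis by (subst prod.reindex[OF inj]) (simp add: inner_axis)
    also have "\<dots> = (\<Prod>j\<in>UNIV. normal_density 0 \<sigma> (x $ j)) * (\<Prod>j\<in>UNIV. if j = i then (x $ j)\<^sup>2 else 1)"
      by (simp add: h_def prod.distrib axis_eq_axis)
    finally show ?thesis by simp
  qed
  then have "(\<integral>\<^sup>+x. ennreal ((\<Prod>j\<in>UNIV. normal_density 0 \<sigma> (x $ j)) * ((x :: real ^ 'n) $ i)\<^sup>2) \<partial>lborel)
      = (\<integral>\<^sup>+x. (\<Prod>b\<in>Basis. ennreal (h b ((x :: real ^ 'n) \<bullet> b))) \<partial>lborel)"
    using h0 by (simp add: prod_ennreal)
  also have "\<dots> = (\<Prod>b\<in>Basis. \<integral>\<^sup>+y. ennreal (h (b :: real ^ 'n) y) \<partial>lborel)"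
    by (rule nn_integral_lborel_prod) (auto simp: h_def)
  also have "\<dots> = (\<Prod>b\<in>Basis. ennreal (LINT y|lborel. h (b :: real ^ 'n) y))"
  proof (rule prod.cong[OF refl], rule nn_integral_eq_integral)
    fix b :: "real ^ 'n"
    show "integrable lborel (h b)"
      using integrable_normal_moment[OF \<sigma>, of 0 2] integrable_normal_density[OF \<sigma>, of 0] by (cases "b = ?b") (simp_all add: h_def[abs_def])
  qed (simp add: h0)
  also have "\<dots> < \<infinity>"
    using h0 by (simp add: prod_ennreal Bochner_Integration.integral_nonneg)
  finally show "(\<integral>\<^sup>+x. ennreal ((\<Prod>j\<in>UNIV. normal_density 0 \<sigma> (x $ j)) * ((x :: real ^ 'n) $ i)\<^sup>2) \<partial>lborel) < \<infinity>" .
qed (auto intro!: prod_nonneg AE_I2 mult_nonneg_nonneg)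

lemma borel_measurable_vec_component [measurable (raw)]:
  fixes f :: "'a \<Rightarrow> 'b::euclidean_space ^ 'n"
  assumes "f \<in> borel_measurable M"
  shows "(\<lambda>x. f x $ i) \<in> borel_measurable M"
  using assms by (rule borel_measurable_continuous_on[rotated]) (intro continuous_intros)

lemma filtered_measurable_mono:
  assumes "filtered M \<F>" "s \<le> t" "f \<in> borel_measurable (\<F> s)"
  shows "f \<in> borel_measurable (\<F> t)"
proof -
  have "filtration (space M) \<F>" using assms(1) by (simp add: filtered_def)
  then have "subalgebra (\<F> t) (\<F> s)"
    using assms(2) by (simp add: subalgebra_def filtration.space_F filtration.sets_F_mono)
  then show ?thesis by (rule measurable_from_subalg) (fact assms(3))
qed

lemma filtered_measurable:
  assumes "filtered M \<F>" "f \<in> borel_measurable (\<F> s)"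
  shows "f \<in> borel_measurable M"
  using assms by (auto simp: filtered_def intro: measurable_from_subalg)

lemma brownian_measurable:
  assumes "filtered M \<F>" "brownian_motion_on M \<F> T B" "t \<in> {0..T}"
  shows "B t \<in> borel_measurable M"
  using assms by (auto simp: brownian_motion_on_def adapted_on_def intro: filtered_measurable)

lemma brownian_increment_moments:
  fixes B :: "real \<Rightarrow> 'a \<Rightarrow> real ^ 'n"
  assumes "brownian_motion_on M \<F> T B" "0 \<le> s" "s < t" "t \<le> T"
  shows "integrable M (\<lambda>x. ((B t x - B s x) $ i)\<^sup>2)" "(LINT x|M. (B t x - B s x) $ i) = 0"
proof -
  have D: "distributed M lborel (\<lambda>x. B t x - B s x)
      (\<lambda>x. ennreal (\<Prod>i\<in>UNIV. normal_density 0 (sqrt (t - s)) (x $ i)))"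
    using assms by (auto simp: brownian_motion_on_def)
  show "integrable M (\<lambda>x. ((B t x - B s x) $ i)\<^sup>2)"
    using product_normal_second_moment[of "sqrt (t - s)" i] assms(3)
    by (subst distributed_integrable[OF D, of "\<lambda>x. (x $ i)\<^sup>2", symmetric]) (auto intro!: prod_nonneg)
  show "(LINT x|M. (B t x - B s x) $ i) = 0"
    using product_normal_mean[of "sqrt (t - s)" i]
    by (subst distributed_integral[OF D, of "\<lambda>x. x $ i", symmetric]) (auto intro!: prod_nonneg)
qed

text \<open>
  The increment is independent of $\mathcal{F}_s$ and has mean zero.
\<close>

lemma brownian_increment_orthogonal:
  fixes B :: "real \<Rightarrow> 'a \<Rightarrow> real ^ 'n"
  assumes M: "prob_space M" and fil: "filtered M \<F>" and B: "brownian_motion_on M \<F> T B"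
    and st: "0 \<le> s" "s \<le> t" "t \<le> T"
    and Y: "Y \<in> borel_measurable (\<F> s)" "integrable M Y"
  shows "integrable M (\<lambda>x. Y x * (B t x - B s x) $ i)" "(LINT x|M. Y x * (B t x - B s x) $ i) = 0"
proof -
  interpret prob_space M by fact
  have "integrable M (\<lambda>x. Y x * (B t x - B s x) $ i) \<and> (LINT x|M. Y x * (B t x - B s x) $ i) = 0"
  proof (cases "s = t")
    case False
    with st have "s < t" by simp
    let ?\<Delta> = "\<lambda>x. B t x - B s x"
    have [measurable]: "B t \<in> borel_measurable M" "B s \<in> borel_measurable M"
      using st by (auto intro: brownian_measurable[OF fil B])
    have [measurable]: "Y \<in> borel_measurable M" using Y(2) by simp
    have ind: "indep_set (sets (\<F> s)) (sets (vimage_algebra (space M) ?\<Delta> borel))"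
      using B st \<open>s < t\<close> by (auto simp: brownian_motion_on_def)
    have sp: "space (\<F> s) = space M"
      using fil by (simp add: filtered_def subalgebra_def)
    have indep: "indep_var borel Y borel (\<lambda>x. ?\<Delta> x $ i)"
      unfolding indep_var_eq
    proof (intro conjI)
      show "random_variable borel Y" "random_variable borel (\<lambda>x. ?\<Delta> x $ i)"
        by measurable
      show "indep_set (sigma_sets (space M) {Y -` A \<inter> space M |A. A \<in> sets borel})
        (sigma_sets (space M) {(\<lambda>x. ?\<Delta> x $ i) -` A \<inter> space M |A. A \<in> sets borel})"
        using ind unfolding indep_set_def
      proof (rule indep_sets_mono_sets)
        have "sigma_sets (space M) {Y -` A \<inter> space M |A. A \<in> sets borel} \<subseteq> sets (\<F> s)"
          unfolding sp[symmetric]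
          by (rule sets.sigma_sets_subset) (use measurable_sets[OF Y(1)] in auto)
        moreover have "sigma_sets (space M) {(\<lambda>x. ?\<Delta> x $ i) -` A \<inter> space M |A. A \<in> sets borel}
          \<subseteq> sets (vimage_algebra (space M) ?\<Delta> borel)"
        proof -
          have *: "(\<lambda>x. ?\<Delta> x $ i) \<in> borel_measurable (vimage_algebra (space M) ?\<Delta> borel)"
            by (rule measurable_compose[OF measurable_vimage_algebra1]) auto
          have "sigma_sets (space (vimage_algebra (space M) ?\<Delta> borel))
              {(\<lambda>x. ?\<Delta> x $ i) -` A \<inter> space (vimage_algebra (space M) ?\<Delta> borel) |A. A \<in> sets borel}
            \<subseteq> sets (vimage_algebra (space M) ?\<Delta> borel)"
            by (intro sets.sigma_sets_subset) (use measurable_sets[OF *] in blast)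
          then show ?thesis by simp
        qed
        ultimately show "(case b of True \<Rightarrow> sigma_sets (space M) {Y -` A \<inter> space M |A. A \<in> sets borel}
            | False \<Rightarrow> sigma_sets (space M) {(\<lambda>x. ?\<Delta> x $ i) -` A \<inter> space M |A. A \<in> sets borel})
          \<subseteq> (case b of True \<Rightarrow> sets (\<F> s) | False \<Rightarrow> sets (vimage_algebra (space M) ?\<Delta> borel))" for b
          by (cases b) auto
      qed
    qed
    have \<Delta>: "integrable M (\<lambda>x. ?\<Delta> x $ i)"
      using brownian_increment_moments(1)[OF B st(1) \<open>s < t\<close> st(3), of i]
      by (intro square_integrable_integrable[OF finite_measure_axioms])
        (simp add: square_integrable_def)
    show ?thesis
      using indep_var_integrable[OF indep Y(2) \<Delta>] indep_var_lebesgue_integral[OF indep Y(2) \<Delta>]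
        brownian_increment_moments(2)[OF B st(1) \<open>s < t\<close> st(3), of i]
      by simp
  qed simp
  then show "integrable M (\<lambda>x. Y x * (B t x - B s x) $ i)" "(LINT x|M. Y x * (B t x - B s x) $ i) = 0"
    by auto
qed

lemma brownian_increment_square_integrable:
  fixes B :: "real \<Rightarrow> 'a \<Rightarrow> real ^ 'n"
  assumes fil: "filtered M \<F>" and B: "brownian_motion_on M \<F> T B"
    and st: "0 \<le> s" "s \<le> t" "t \<le> T"
  shows "square_integrable M (\<lambda>x. B t x - B s x)"
proof (cases "s = t")
  case False
  have [measurable]: "B t \<in> borel_measurable M" "B s \<in> borel_measurable M"
    using st by (auto intro: brownian_measurable[OF fil B])
  have "integrable M (\<lambda>x. \<Sum>i\<in>UNIV. ((B t x - B s x) $ i)\<^sup>2)"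
    using brownian_increment_moments(1)[OF B] st False by (intro Bochner_Integration.integrable_sum) auto
  then show ?thesis
    by (simp add: square_integrable_def norm_vec_def L2_set_def sum_nonneg)
qed (simp add: square_integrable_def)


section \<open>Orthogonality of the stochastic integral to the past\<close>

lemma norm_matrix_vector_mult_le:
  fixes A :: "real ^ 'n ^ 'm" and x :: "real ^ 'n"
  shows "norm (A *v x) \<le> real CARD('m) * norm A * norm x"
proof -
  have "norm (A *v x) \<le> (\<Sum>i\<in>UNIV. \<bar>(A *v x) $ i\<bar>)" by (rule norm_le_l1_cart)
  also have "\<dots> \<le> (\<Sum>i\<in>(UNIV :: 'm set). norm A * norm x)"
  proof (rule sum_mono)
    fix i
    have "\<bar>(A *v x) $ i\<bar> \<le> norm (A $ i) * norm x"
      by (simp add: matrix_vector_mul_component Cauchy_Schwarz_ineq2)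
    also have "\<dots> \<le> norm A * norm x" by (intro mult_right_mono Finite_Cartesian_Product.norm_nth_le) simp
    finally show "\<bar>(A *v x) $ i\<bar> \<le> norm A * norm x" .
  qed
  also have "\<dots> = real CARD('m) * norm A * norm x" by simp
  finally show ?thesis .
qed

lemma borel_measurable_matrix_vector_mult [measurable]:
  fixes A :: "'a \<Rightarrow> real ^ 'n ^ 'm" and v :: "'a \<Rightarrow> real ^ 'n"
  assumes [measurable]: "A \<in> borel_measurable M" "v \<in> borel_measurable M"
  shows "(\<lambda>x. A x *v v x) \<in> borel_measurable M"
proof -
  have "continuous_on UNIV (\<lambda>p :: (real ^ 'n ^ 'm) \<times> (real ^ 'n). fst p *v snd p)"
    unfolding matrix_vector_mult_def by (intro continuous_intros)
  then have [measurable]: "(\<lambda>p :: (real ^ 'n ^ 'm) \<times> (real ^ 'n). fst p *v snd p) \<in> borel_measurable borel"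
    by (rule borel_measurable_continuous_onI)
  have [measurable]: "(\<lambda>x. (A x, v x)) \<in> borel_measurable M"
    by (rule borel_measurable_Pair) auto
  have "(\<lambda>x. (\<lambda>p. fst p *v snd p) (A x, v x)) \<in> borel_measurable M"
    by (rule measurable_compose[of _ _ borel]) measurable
  then show ?thesis by simp
qed

lemma mono_steps:
  fixes \<tau> :: "nat \<Rightarrow> real"
  assumes "\<forall>k<n. \<tau> k \<le> \<tau> (Suc k)" "j \<le> k" "k \<le> n"
  shows "\<tau> j \<le> \<tau> k"
  using assms(2,3)
proof (induction k rule: dec_induct)
  case (step m)
  then show ?case using assms(1) by (auto intro: order_trans)
qed simp

text \<open>
  In coordinates each summand of the pairing is a product of an increment over
  $(\tau_k,\tau_{k+1}]$ and the variable $V_i\,(\xi_k)_{ij}$, which is known at time $\tau_k$ since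
  $t \le \tau_k$.
\<close>

lemma simple_ito_orthogonal:
  fixes B :: "real \<Rightarrow> 'a \<Rightarrow> real ^ 'n"
  assumes M: "prob_space M" and fil: "filtered M \<F>" and B: "brownian_motion_on M \<F> T B"
    and t: "0 \<le> t" and sim: "simple_integrand \<F> t T n \<tau> \<xi>"
    and V: "V \<in> borel_measurable (\<F> t)" "square_integrable M V"
  shows "square_integrable M (simple_ito B n \<tau> \<xi>)" "l2_inner M V (simple_ito B n \<tau> \<xi>) = 0"
proof -
  interpret prob_space M by fact
  have mono: "\<tau> j \<le> \<tau> k" if "j \<le> k" "k \<le> n" for j k
    using sim that by (auto simp: simple_integrand_def intro: mono_steps)
  let ?J = "\<lambda>k x. \<xi> k x *v (B (\<tau> (Suc k)) x - B (\<tau> k) x)"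
  have summand: "square_integrable M (?J k) \<and> l2_inner M V (?J k) = 0" if k: "k < n" for k
  proof -
    have \<tau>: "t \<le> \<tau> k" "\<tau> k \<le> \<tau> (Suc k)" "\<tau> (Suc k) \<le> T"
      using mono[of 0 k] mono[of k "Suc k"] mono[of "Suc k" n] k sim by (auto simp: simple_integrand_def)
    then have \<tau>0: "0 \<le> \<tau> k" using t by simp
    let ?\<Delta> = "\<lambda>x. B (\<tau> (Suc k)) x - B (\<tau> k) x"
    have \<Delta>: "square_integrable M ?\<Delta>"
      using brownian_increment_square_integrable[OF fil B \<tau>0 \<tau>(2,3)] .
    have \<xi>: "\<xi> k \<in> borel_measurable (\<F> (\<tau> k))"
      using sim k by (auto simp: simple_integrand_def)
    obtain c where c: "\<And>x. x \<in> space M \<Longrightarrow> norm (\<xi> k x) \<le> c"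
      using sim k fil by (fastforce simp: simple_integrand_def filtered_def subalgebra_def)
    have [measurable]: "\<xi> k \<in> borel_measurable M" "?\<Delta> \<in> borel_measurable M"
      using filtered_measurable[OF fil \<xi>] \<Delta> by (auto simp: square_integrable_def)
    have J: "square_integrable M (?J k)"
    proof (rule square_integrable_bound)
      show "integrable M (\<lambda>x. (real CARD('n) * c)\<^sup>2 * (norm (?\<Delta> x))\<^sup>2)"
        using \<Delta> by (simp add: square_integrable_def)
      fix x assume x: "x \<in> space M"
      have "norm (?J k x) \<le> real CARD('n) * norm (\<xi> k x) * norm (?\<Delta> x)"
        by (rule norm_matrix_vector_mult_le)
      also have "\<dots> \<le> real CARD('n) * c * norm (?\<Delta> x)"
        using c[OF x] by (intro mult_right_mono mult_left_mono) auto
      finally show "(norm (?J k x))\<^sup>2 \<le> (real CARD('n) * c)\<^sup>2 * (norm (?\<Delta> x))\<^sup>2"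
        unfolding power_mult_distrib[symmetric] by (intro power_mono) auto
    qed measurable
    have V\<tau>: "V \<in> borel_measurable (\<F> (\<tau> k))"
      by (rule filtered_measurable_mono[OF fil \<tau>(1) V(1)])
    have Y: "(\<lambda>x. V x $ i * \<xi> k x $ i $ j) \<in> borel_measurable (\<F> (\<tau> k))"
      "integrable M (\<lambda>x. V x $ i * \<xi> k x $ i $ j)" for i j
    proof -
      show 1: "(\<lambda>x. V x $ i * \<xi> k x $ i $ j) \<in> borel_measurable (\<F> (\<tau> k))"
        using V\<tau> \<xi> by measurable
      show "integrable M (\<lambda>x. V x $ i * \<xi> k x $ i $ j)"
      proof (rule Bochner_Integration.integrable_bound)
        show "integrable M (\<lambda>x. c *\<^sub>R V x)"
          using square_integrable_integrable[OF finite_measure_axioms V(2)] by simp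
        show "AE x in M. norm (V x $ i * \<xi> k x $ i $ j) \<le> norm (c *\<^sub>R V x)"
        proof (rule AE_I2)
          fix x assume x: "x \<in> space M"
          have "\<bar>\<xi> k x $ i $ j\<bar> \<le> c"
            using component_le_norm_cart[of "\<xi> k x $ i" j] Finite_Cartesian_Product.norm_nth_le[of "\<xi> k x" i] c[OF x] by linarith
          then have "\<bar>V x $ i\<bar> * \<bar>\<xi> k x $ i $ j\<bar> \<le> norm (V x) * c"
            by (intro mult_mono component_le_norm_cart) auto
          also have "\<dots> \<le> norm (c *\<^sub>R V x)" by (simp add: mult.commute mult_right_mono)
          finally show "norm (V x $ i * \<xi> k x $ i $ j) \<le> norm (c *\<^sub>R V x)" by (simp add: abs_mult)
        qed
      qed (rule filtered_measurable[OF fil 1])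
    qed
    note orth = brownian_increment_orthogonal[OF M fil B \<tau>0 \<tau>(2,3) Y]
    have "l2_inner M V (?J k) = (LINT x|M. (\<Sum>i\<in>UNIV. \<Sum>j\<in>UNIV. V x $ i * \<xi> k x $ i $ j * ?\<Delta> x $ j))"
      unfolding l2_inner_def
      by (intro Bochner_Integration.integral_cong refl)
        (simp add: inner_vec_def matrix_vector_mult_def sum_distrib_left mult.assoc)
    also have "\<dots> = (\<Sum>i\<in>UNIV. \<Sum>j\<in>UNIV. LINT x|M. V x $ i * \<xi> k x $ i $ j * ?\<Delta> x $ j)"
      by (simp add: orth(1) del: vector_minus_component)
    also have "\<dots> = 0" by (simp add: orth(2) del: vector_minus_component)
    finally show ?thesis using J by simp
  qed
  have "simple_ito B n \<tau> \<xi> = (\<lambda>x. \<Sum>k<n. ?J k x)" by (auto simp: simple_ito_def)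
  moreover have J: "square_integrable M (?J k)" if "k \<in> {..<n}" for k
    using summand that by auto
  ultimately show "square_integrable M (simple_ito B n \<tau> \<xi>)" "l2_inner M V (simple_ito B n \<tau> \<xi>) = 0"
    using square_integrable_sum[OF finite_lessThan J] l2_inner_sum_right[OF finite_lessThan J V(2)] summand
    by auto
qed

text \<open>
  Orthogonality passes from simple integrands to their $L^2$ limit.
\<close>

lemma ito_integral_orthogonal:
  fixes B :: "real \<Rightarrow> 'a \<Rightarrow> real ^ 'n"
  assumes M: "prob_space M" and fil: "filtered M \<F>" and B: "brownian_motion_on M \<F> T B"
    and t: "0 \<le> t" and I: "has_ito_integral M \<F> B Z t T I"
    and V: "V \<in> borel_measurable (\<F> t)" "square_integrable M V"
  shows "l2_inner M V I = 0"
proof -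
  obtain n \<tau> \<xi> where sim: "\<And>m. simple_integrand \<F> t T (n m) (\<tau> m) (\<xi> m)"
    and lim: "(\<lambda>m. l2_dist M I (simple_ito B (n m) (\<tau> m) (\<xi> m))) \<longlonglongrightarrow> 0"
    using I unfolding has_ito_integral_def by blast
  have I2: "square_integrable M I" using I by (simp add: has_ito_integral_def)
  note orth = simple_ito_orthogonal[OF M fil B t sim V]
  have "\<bar>l2_inner M V I\<bar> \<le> l2_norm M V * l2_dist M I (simple_ito B (n m) (\<tau> m) (\<xi> m))" for m
    using l2_inner_le[OF V(2) square_integrable_diff[OF I2 orth(1)[of m]]]
      l2_inner_diff_right[OF I2 orth(1)[of m] V(2)] orth(2)[of m]
    by (simp add: l2_dist_def)
  moreover have "(\<lambda>m. l2_norm M V * l2_dist M I (simple_ito B (n m) (\<tau> m) (\<xi> m))) \<longlonglongrightarrow> l2_norm M V * 0"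
    by (intro tendsto_intros lim)
  ultimately have "\<bar>l2_inner M V I\<bar> \<le> l2_norm M V * 0"
    by (intro LIMSEQ_le_const) auto
  then show ?thesis by simp
qed


section \<open>Lifted coefficients\<close>

text \<open>
  The diagonal coupling has cost zero.  This is what makes joint continuity in the point and the
  measure imply continuity in the point.
\<close>

lemma wasserstein2_self:
  fixes \<mu> :: "'b::euclidean_space measure"
  assumes "\<mu> \<in> P2"
  shows "wasserstein2 \<mu> \<mu> = 0"
proof -
  have sets [measurable_cong]: "sets \<mu> = sets borel" using assms by (simp add: P2_def)
  let ?\<pi> = "distr \<mu> (borel \<Otimes>\<^sub>M borel) (\<lambda>x. (x, x))"
  let ?cost = "\<lambda>\<pi>. LINT p|\<pi>. (norm (fst p - snd p :: 'b))\<^sup>2"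
  have diag: "?\<pi> \<in> couplings \<mu> \<mu>"
    using distr_id2[OF sets[symmetric]] by (simp add: couplings_def distr_distr comp_def)
  have nonneg: "0 \<le> ?cost \<pi>" for \<pi>
    by (simp add: Bochner_Integration.integral_nonneg)
  have "(INF \<pi>\<in>couplings \<mu> \<mu>. ?cost \<pi>) \<le> ?cost ?\<pi>"
    using nonneg by (intro cINF_lower[OF _ diag] bdd_belowI2)
  also have "?cost ?\<pi> = 0"
    by (subst integral_distr) auto
  finally have "(INF \<pi>\<in>couplings \<mu> \<mu>. ?cost \<pi>) \<le> 0" .
  moreover have "0 \<le> (INF \<pi>\<in>couplings \<mu> \<mu>. ?cost \<pi>)"
    using diag nonneg by (intro cINF_greatest) auto
  ultimately have "(INF \<pi>\<in>couplings \<mu> \<mu>. ?cost \<pi>) = 0" by (rule antisym)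
  then show ?thesis by (simp add: wasserstein2_def)
qed

lemma continuous_P2_section:
  assumes "continuous_P2 f" "\<mu> \<in> P2"
  shows "continuous_on UNIV (\<lambda>x. f x \<mu>)"
  unfolding continuous_on_iff
proof (intro ballI allI impI)
  fix x and e :: real assume "0 < e"
  then obtain d where "d > 0" "\<And>y \<nu>. \<nu> \<in> P2 \<Longrightarrow> dist x y < d \<and> wasserstein2 \<mu> \<nu> < d \<Longrightarrow> dist (f x \<mu>) (f y \<nu>) < e"
    using assms unfolding continuous_P2_def by meson
  then show "\<exists>d>0. \<forall>x'\<in>UNIV. dist x' x < d \<longrightarrow> dist (f x' \<mu>) (f x \<mu>) < e"
    using wasserstein2_self[OF assms(2)] assms(2) by (auto simp: dist_commute)
qed

lemma law_in_P2:
  assumes "prob_space M" "square_integrable M X"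
  shows "law M X \<in> P2" "sqrt (E2 (law M X)) = l2_norm M X"
proof -
  have X [measurable]: "X \<in> borel_measurable M" using assms(2) by (simp add: square_integrable_def)
  show "law M X \<in> P2"
    using assms prob_space.prob_space_distr[OF assms(1) X]
    by (simp add: P2_def law_def square_integrable_def integrable_distr_eq)
  show "sqrt (E2 (law M X)) = l2_norm M X"
    by (simp add: E2_def law_def l2_norm_def integral_distr)
qed

lemma measurable_coefficient1:
  fixes f :: "'b::euclidean_space \<Rightarrow> 'c::euclidean_space measure \<Rightarrow> 'd::euclidean_space"
  assumes "continuous_P2 f" "\<mu> \<in> P2" "X \<in> borel_measurable N"
  shows "(\<lambda>\<eta>. f (X \<eta>) \<mu>) \<in> borel_measurable N"
  using continuous_P2_section[OF assms(1,2)] assms(3) by (rule borel_measurable_continuous_on)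

lemma measurable_coefficient2:
  fixes f :: "'b::euclidean_space \<Rightarrow> 'c::euclidean_space measure \<Rightarrow> 'b \<Rightarrow> 'd::euclidean_space"
  assumes "continuous_P2 (\<lambda>(x, u) \<mu>. f x \<mu> u)" "\<mu> \<in> P2" "X \<in> borel_measurable N" "U \<in> borel_measurable N"
  shows "(\<lambda>\<eta>. f (X \<eta>) \<mu> (U \<eta>)) \<in> borel_measurable N"
  using measurable_coefficient1[OF assms(1,2) borel_measurable_Pair[OF assms(3,4)]] by simp

lemma square_le_growth:
  fixes a b c n k :: real
  assumes "n \<le> k * (1 + a + b + c)" "0 \<le> n"
  shows "n\<^sup>2 \<le> 4 * k\<^sup>2 * (1 + a\<^sup>2 + b\<^sup>2 + c\<^sup>2)"
proof -
  \<comment> \<open>Lagrange's identity for the vectors $(1,a,b,c)$ and $(1,1,1,1)$\<close>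
  have "(1 + a + b + c)\<^sup>2 + ((1 - a)\<^sup>2 + (1 - b)\<^sup>2 + (1 - c)\<^sup>2 + (a - b)\<^sup>2 + (a - c)\<^sup>2 + (b - c)\<^sup>2)
      = 4 * (1 + a\<^sup>2 + b\<^sup>2 + c\<^sup>2)"
    by (simp add: power2_eq_square algebra_simps)
  moreover have "0 \<le> (1 - a)\<^sup>2 + (1 - b)\<^sup>2 + (1 - c)\<^sup>2 + (a - b)\<^sup>2 + (a - c)\<^sup>2 + (b - c)\<^sup>2"
    by simp
  ultimately have "(1 + a + b + c)\<^sup>2 \<le> 4 * (1 + a\<^sup>2 + b\<^sup>2 + c\<^sup>2)" by linarith
  then have "k\<^sup>2 * (1 + a + b + c)\<^sup>2 \<le> k\<^sup>2 * (4 * (1 + a\<^sup>2 + b\<^sup>2 + c\<^sup>2))"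
    by (rule mult_left_mono) simp
  moreover have "n\<^sup>2 \<le> (k * (1 + a + b + c))\<^sup>2" using assms by (intro power_mono)
  ultimately have "n\<^sup>2 \<le> k\<^sup>2 * (4 * (1 + a\<^sup>2 + b\<^sup>2 + c\<^sup>2))"
    by (simp only: power_mult_distrib)
  then show ?thesis by (simp only: mult_ac)
qed

lemma square_integrable_lift1:
  fixes f :: "'b::euclidean_space \<Rightarrow> 'b measure \<Rightarrow> 'b"
  assumes M: "prob_space M" and cont: "continuous_P2 f"
    and growth: "\<And>x \<mu>. \<mu> \<in> P2 \<Longrightarrow> norm (f x \<mu>) \<le> k * (1 + norm x + sqrt (E2 \<mu>))"
    and X: "square_integrable M X"
  shows "square_integrable M (lift1 M f X)"
proof (rule square_integrable_bound)
  interpret prob_space M by fact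
  note law = law_in_P2[OF M X]
  show "lift1 M f X \<in> borel_measurable M"
    unfolding lift1_def
    by (rule measurable_coefficient1[OF cont law(1) square_integrableD(1)[OF X]])
  show "integrable M (\<lambda>\<eta>. 4 * k\<^sup>2 * (1 + (norm (X \<eta>))\<^sup>2 + 0\<^sup>2 + (l2_norm M X)\<^sup>2))"
    using X by (simp add: square_integrable_def)
  show "(norm (lift1 M f X \<eta>))\<^sup>2 \<le> 4 * k\<^sup>2 * (1 + (norm (X \<eta>))\<^sup>2 + 0\<^sup>2 + (l2_norm M X)\<^sup>2)" for \<eta>
    using growth[OF law(1), of "X \<eta>"] by (intro square_le_growth) (simp_all add: lift1_def law(2))
qed

lemma square_integrable_lift2:
  fixes f :: "'b::euclidean_space \<Rightarrow> 'b measure \<Rightarrow> 'b \<Rightarrow> 'b"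
  assumes M: "prob_space M" and cont: "continuous_P2 (\<lambda>(x, u) \<mu>. f x \<mu> u)"
    and growth: "\<And>x \<mu> u. \<mu> \<in> P2 \<Longrightarrow> norm (f x \<mu> u) \<le> k * (1 + norm x + norm u + sqrt (E2 \<mu>))"
    and X: "square_integrable M X" and U: "square_integrable M U"
  shows "square_integrable M (lift2 M f X U)"
proof (rule square_integrable_bound)
  interpret prob_space M by fact
  note law = law_in_P2[OF M X]
  show "lift2 M f X U \<in> borel_measurable M"
    unfolding lift2_def
    by (rule measurable_coefficient2[OF cont law(1) square_integrableD(1)[OF X] square_integrableD(1)[OF U]])
  show "integrable M (\<lambda>\<eta>. 4 * k\<^sup>2 * (1 + (norm (X \<eta>))\<^sup>2 + (norm (U \<eta>))\<^sup>2 + (l2_norm M X)\<^sup>2))"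
    using X U by (simp add: square_integrable_def)
  show "(norm (lift2 M f X U \<eta>))\<^sup>2 \<le> 4 * k\<^sup>2 * (1 + (norm (X \<eta>))\<^sup>2 + (norm (U \<eta>))\<^sup>2 + (l2_norm M X)\<^sup>2)" for \<eta>
    using growth[OF law(1), of "X \<eta>" "U \<eta>"] by (intro square_le_growth) (simp_all add: lift2_def law(2))
qed

text \<open>
  Joint measurability is read off from the integrability of the drift; linear growth improves
  integrability to square integrability.
\<close>

lemma square_integrable_lift2_process:
  fixes f :: "'b::euclidean_space \<Rightarrow> 'b measure \<Rightarrow> 'b \<Rightarrow> 'b"
  assumes M: "prob_space M" and N: "finite_measure (N :: real measure)"
    and growth: "\<And>x \<mu> u. \<mu> \<in> P2 \<Longrightarrow> norm (f x \<mu> u) \<le> k * (1 + norm x + norm u + sqrt (E2 \<mu>))"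
    and X: "square_integrable (N \<Otimes>\<^sub>M M) (case_prod X)" "\<And>s. s \<in> space N \<Longrightarrow> square_integrable M (X s)"
    and U: "square_integrable (N \<Otimes>\<^sub>M M) (case_prod U)"
    and f: "integrable (N \<Otimes>\<^sub>M M) (\<lambda>(s, \<eta>). lift2 M f (X s) (U s) \<eta>)"
  shows "square_integrable (N \<Otimes>\<^sub>M M) (\<lambda>(s, \<eta>). lift2 M f (X s) (U s) \<eta>)"
proof (rule square_integrable_bound)
  interpret prob_space M by fact
  interpret N: finite_measure N by fact
  interpret NM: finite_measure "N \<Otimes>\<^sub>M M"
    using finite_measure_axioms N by (rule finite_measure_pair_measure)
  show "(\<lambda>(s, \<eta>). lift2 M f (X s) (U s) \<eta>) \<in> borel_measurable (N \<Otimes>\<^sub>M M)"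
    using f by simp
  show "integrable (N \<Otimes>\<^sub>M M) (\<lambda>z. 4 * k\<^sup>2 *
      (1 + (norm (case_prod X z))\<^sup>2 + (norm (case_prod U z))\<^sup>2 + (l2_norm M (X (fst z)))\<^sup>2))"
    using X(1) U integrable_comp_fst[OF N.sigma_finite_measure_axioms finite_measure_axioms
        integrable_l2_norm_square[OF N finite_measure_axioms X(1)]]
    by (simp add: square_integrable_def)
  fix z assume "z \<in> space (N \<Otimes>\<^sub>M M)"
  then have "fst z \<in> space N" by (auto simp: space_pair_measure)
  note law = law_in_P2[OF M X(2)[OF this]]
  show "(norm (case z of (s, \<eta>) \<Rightarrow> lift2 M f (X s) (U s) \<eta>))\<^sup>2
    \<le> 4 * k\<^sup>2 * (1 + (norm (case_prod X z))\<^sup>2 + (norm (case_prod U z))\<^sup>2 + (l2_norm M (X (fst z)))\<^sup>2)"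
    using growth[OF law(1), of "X (fst z) (snd z)" "U (fst z) (snd z)"]
    by (intro square_le_growth) (simp_all add: lift2_def law(2) case_prod_unfold)
qed

text \<open>
  The properties of the drifts $\tilde F(X_s,W_s)$ and $\tilde G(X_s,W_s)$ along a solution that let
  them be paired with the stochastic integral and serve as derivatives of curves.
\<close>

lemma strong_solution_coefficient:
  fixes H :: "real ^ 'n \<Rightarrow> (real ^ 'n) measure \<Rightarrow> real ^ 'n \<Rightarrow> real ^ 'n"
  assumes M: "prob_space M" and fil: "filtered M \<F>"
    and cont: "continuous_P2 (\<lambda>(x, u) \<mu>. H x \<mu> u)"
    and growth: "\<And>x \<mu> u. \<mu> \<in> P2 \<Longrightarrow> norm (H x \<mu> u) \<le> k * (1 + norm x + norm u + sqrt (E2 \<mu>))"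
    and sol: "strong_solution M \<F> T B \<sigma> W\<^sub>0 F G X\<^sub>0 X W Z"
    and H: "H = F \<or> H = G"
  shows "square_integrable (clock T \<Otimes>\<^sub>M M) (\<lambda>(s, \<eta>). lift2 M H (X s) (W s) \<eta>)"
    and "s \<in> {0..T} \<Longrightarrow> square_integrable M (lift2 M H (X s) (W s))"
    and "s \<in> {0..T} \<Longrightarrow> lift2 M H (X s) (W s) \<in> borel_measurable (\<F> s)"
proof -
  have XW: "square_integrable M (X s)" "square_integrable M (W s)" if "s \<in> {0..T}" for s
    using sol that by (auto simp: strong_solution_def)
  show "square_integrable (clock T \<Otimes>\<^sub>M M) (\<lambda>(s, \<eta>). lift2 M H (X s) (W s) \<eta>)"
    using sol H XW
    by (intro square_integrable_lift2_process[OF M finite_measure_clock growth])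
      (auto simp: strong_solution_def time_prod_def space_clock)
  assume s: "s \<in> {0..T}"
  show "square_integrable M (lift2 M H (X s) (W s))"
    by (rule square_integrable_lift2[OF M cont growth XW[OF s]])
  show "lift2 M H (X s) (W s) \<in> borel_measurable (\<F> s)"
    unfolding lift2_def using sol s
    by (intro measurable_coefficient2[OF cont law_in_P2(1)[OF M XW(1)[OF s]]])
      (auto simp: strong_solution_def adapted_on_def)
qed


section \<open>The estimate for a monotone forward-backward pair of curves\<close>

text \<open>
  A linear bound $e \le R d$ is compatible with the mixed norm $\max(d, d^\gamma)$, since
  $(1+R)^\gamma \le 1 + R$.
\<close>

lemma max_powr_bound:
  fixes R d e \<gamma> :: real
  assumes R: "0 \<le> R" and d: "0 \<le> d" and e: "0 \<le> e" "e \<le> R * d" and \<gamma>: "0 < \<gamma>" "\<gamma> \<le> 1"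
  shows "max e (e powr \<gamma>) \<le> (1 + R) * max d (d powr \<gamma>)"
proof (rule max.boundedI)
  have "e \<le> R * d" by (rule e(2))
  also have "\<dots> \<le> (1 + R) * max d (d powr \<gamma>)"
    using R d by (intro mult_mono) auto
  finally show "e \<le> (1 + R) * max d (d powr \<gamma>)" .
  have "e powr \<gamma> \<le> ((1 + R) * d) powr \<gamma>"
    using e R d \<gamma> by (intro powr_mono2) (auto simp: algebra_simps)
  also have "\<dots> = (1 + R) powr \<gamma> * d powr \<gamma>"
    using R d by (simp add: powr_mult)
  also have "\<dots> \<le> (1 + R) * max d (d powr \<gamma>)"
    using R \<gamma> powr_mono[of \<gamma> 1 "1 + R"] by (intro mult_mono) auto
  finally show "e powr \<gamma> \<le> (1 + R) * max d (d powr \<gamma>)" .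
qed

text \<open>
  The analytic core.  $D$ is the forward difference, $E$ the backward one, and $Q$ the absolutely
  continuous curve of which $E_s$ is the projection onto the past of $s$; the conditions
  \<open>proj_f\<close>, \<open>proj_g\<close>, \<open>proj_D\<close> and \<open>proj_E\<close> express
  this projection through pairings.  \<open>R\<close> is the Lipschitz constant of $D_0 \mapsto E$, uniformly in
  time, and the factor under the square root comes from Gronwall's inequality for $\|D\|^2$.
\<close>

lemma forward_backward_estimate:
  fixes D E Q f g :: "real \<Rightarrow> 'a \<Rightarrow> 'b::euclidean_space" and T \<alpha> L a c \<gamma> :: real
  assumes M: "finite_measure M" and T: "0 < T"
    and const: "0 < \<alpha>" "0 \<le> L" "0 < a" "0 \<le> c" "0 < \<gamma>" "\<gamma> \<le> 1"
    and D: "has_l2_derivative M T D (\<lambda>s x. - f s x)"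
    and Q: "has_l2_derivative M T Q (\<lambda>s x. - g s x)"
    and E: "\<And>s. s \<in> {0..T} \<Longrightarrow> square_integrable M (E s)"
    and intD: "integrable (clock T) (\<lambda>s. (l2_norm M (D s))\<^sup>2)"
    and intE: "integrable (clock T) (\<lambda>s. (l2_norm M (E s))\<^sup>2)"
    and proj_f: "\<And>s. s \<in> {0..T} \<Longrightarrow> l2_inner M (f s) (Q s) = l2_inner M (f s) (E s)"
    and proj_g: "\<And>s. s \<in> {0..T} \<Longrightarrow> l2_inner M (g s) (Q s) = l2_inner M (g s) (E s)"
    and proj_D: "\<And>s. s \<in> {0..T} \<Longrightarrow> l2_inner M (D s) (Q s) = l2_inner M (D s) (E s)"
    and proj_E: "\<And>s. s \<in> {0..T} \<Longrightarrow> l2_norm M (E s) \<le> l2_norm M (Q s)"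
    and terminal: "a * (l2_norm M (Q T))\<^sup>2 \<le> l2_inner M (D T) (Q T)"
    and mono: "\<And>s. s \<in> {0..T} \<Longrightarrow> 0 \<le> l2_inner M (g s) (D s) + l2_inner M (f s) (E s)"
    and strong: "\<And>s. s \<in> {0..T} \<Longrightarrow> \<alpha> * (l2_norm M (D s))\<^sup>2 - L * (l2_norm M (E s))\<^sup>2
      \<le> l2_inner M (g s) (D s) + l2_inner M (f s) (E s)"
    and bound_g: "\<And>s. s \<in> {0..T} \<Longrightarrow>
      l2_inner M (g s) (E s) \<le> c * ((l2_norm M (D s))\<^sup>2 + (l2_norm M (E s))\<^sup>2)"
    and bound_f: "\<And>s. s \<in> {0..T} \<Longrightarrow> - c * ((l2_norm M (D s))\<^sup>2
        + (max (l2_norm M (E s)) (l2_norm M (E s) powr \<gamma>))\<^sup>2) \<le> l2_inner M (f s) (D s)"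
    and R: "R = 2 * (1 / a + 2 * c / \<alpha>) * exp (2 * (2 * c * (1 + L / \<alpha>)) * T)"
    and t: "t \<in> {0..T}"
  shows "l2_norm M (D t) \<le> sqrt (2 * (1 + 2 * c * T * (1 + R)\<^sup>2) * exp (2 * (2 * c) * T))
    * max (l2_norm M (D 0)) (l2_norm M (D 0) powr \<gamma>)"
proof -
  let ?D = "\<lambda>s. (l2_norm M (D s))\<^sup>2" and ?E = "\<lambda>s. (l2_norm M (E s))\<^sup>2"
  let ?J = "\<lambda>a b h. LINT s:{a..b}|clock T. h s"
  let ?\<psi> = "\<lambda>s. l2_inner M (D s) (Q s)"
  let ?fE = "\<lambda>s. l2_inner M (f s) (E s)" and ?gD = "\<lambda>s. l2_inner M (g s) (D s)"
  let ?gE = "\<lambda>s. l2_inner M (g s) (E s)" and ?fD = "\<lambda>s. l2_inner M (f s) (D s)"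
  note DQ = l2_product_rule[OF M D Q] and DD = l2_product_rule[OF M D D] and QQ = l2_product_rule[OF M Q Q]
  have cong: "integrable (clock T) u \<Longrightarrow> (\<And>s. s \<in> {0..T} \<Longrightarrow> v s = u s) \<Longrightarrow> integrable (clock T) v"
    for u v :: "real \<Rightarrow> real"
    by (erule iffD1[OF Bochner_Integration.integrable_cong, rotated -1]) (auto simp: space_clock)
  have int: "integrable (clock T) ?fE" "integrable (clock T) ?gD"
      "integrable (clock T) ?gE" "integrable (clock T) ?fD"
    using cong[OF Bochner_Integration.integrable_minus[OF DQ(1)], of ?fE]
      cong[OF Bochner_Integration.integrable_minus[OF DQ(2)], of ?gD]
      cong[OF Bochner_Integration.integrable_minus[OF QQ(1)], of ?gE]
      cong[OF Bochner_Integration.integrable_minus[OF DD(1)], of ?fD]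
      proj_f proj_g
    by (auto simp: l2_inner_minus_left l2_inner_commute[of M "D _" "\<lambda>x. - g _ x"])
  have Jcong: "?J r b u = ?J r b v" if "0 \<le> r" "b \<le> T" "\<And>s. s \<in> {0..T} \<Longrightarrow> u s = v s"
    for r b and u v :: "real \<Rightarrow> real"
    unfolding set_lebesgue_integral_def
    by (intro Bochner_Integration.integral_cong refl) (use that in \<open>auto simp: indicator_def\<close>)
  have Jneg: "?J r b (\<lambda>s. - u s) = - ?J r b u" for r b and u :: "real \<Rightarrow> real"
    by (simp add: set_lebesgue_integral_def)
  have \<psi>_diff: "?\<psi> r - ?\<psi> b = ?J r b (\<lambda>s. ?gD s + ?fE s)" if "0 \<le> r" "r \<le> b" "b \<le> T" for r b
  proof -
    have "?J r b (\<lambda>s. l2_inner M (\<lambda>x. - f s x) (Q s)) = - ?J r b ?fE"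
      unfolding Jneg[symmetric] using that proj_f by (intro Jcong) (auto simp: l2_inner_minus_left)
    moreover have "?J r b (\<lambda>s. l2_inner M (D s) (\<lambda>x. - g s x)) = - ?J r b ?gD"
      unfolding Jneg[symmetric] using that
      by (intro Jcong) (auto simp: l2_inner_minus_left l2_inner_commute[of M "D _" "\<lambda>x. - g _ x"])
    ultimately show ?thesis
      using DQ(3)[OF that] set_integral_clock_add[OF int(2,1), of r b] by simp
  qed
  have Q_diff: "(l2_norm M (Q r))\<^sup>2 = (l2_norm M (Q T))\<^sup>2 + 2 * ?J r T ?gE" if "0 \<le> r" "r \<le> T" for r
  proof -
    have "?J r T (\<lambda>s. l2_inner M (\<lambda>x. - g s x) (Q s)) = - ?J r T ?gE"
      unfolding Jneg[symmetric] using that proj_g by (intro Jcong) (auto simp: l2_inner_minus_left)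
    then show ?thesis
      using QQ(3)[OF that order_refl] by (simp add: l2_norm_square l2_inner_commute[of M "Q _" "\<lambda>x. - g _ x"])
  qed
  have D_diff: "?D r = ?D 0 - 2 * ?J 0 r ?fD" if "0 \<le> r" "r \<le> T" for r
  proof -
    have "?J 0 r (\<lambda>s. l2_inner M (\<lambda>x. - f s x) (D s)) = - ?J 0 r ?fD"
      unfolding Jneg[symmetric] using that by (intro Jcong) (auto simp: l2_inner_minus_left)
    then show ?thesis
      using DD(3)[OF order_refl that] by (simp add: l2_norm_square l2_inner_commute[of M "D _" "\<lambda>x. - f _ x"])
  qed
  have J0: "0 \<le> ?J r b u" if "0 \<le> r" "b \<le> T" "\<And>s. s \<in> {0..T} \<Longrightarrow> 0 \<le> u s" for r b and u :: "real \<Rightarrow> real"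
    unfolding set_lebesgue_integral_def
    by (rule Bochner_Integration.integral_nonneg) (use that in \<open>auto simp: indicator_def\<close>)
  have Jscale: "?J r b (\<lambda>s. k * u s) = k * ?J r b u" for k r b and u :: "real \<Rightarrow> real"
    by simp
  have \<psi>T: "0 \<le> ?\<psi> T" "(l2_norm M (Q T))\<^sup>2 \<le> ?\<psi> T / a"
  proof -
    show "0 \<le> ?\<psi> T" using const(3) by (intro order_trans[OF _ terminal]) simp
    show "(l2_norm M (Q T))\<^sup>2 \<le> ?\<psi> T / a" using terminal const(3) by (simp add: field_simps)
  qed
  have \<psi>_le: "?\<psi> b \<le> ?\<psi> r" if "0 \<le> r" "r \<le> b" "b \<le> T" for r b
    using \<psi>_diff[OF that] J0[of r b "\<lambda>s. ?gD s + ?fE s"] that mono by simp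

  \<comment> \<open>The backward energy inequality, closed by the pairing: $\int\|D\|^2$ is traded for $\psi(0)$ and $\int\|E\|^2$.\<close>
  let ?K = "2 * c * (1 + L / \<alpha>)" and ?k = "1 / a + 2 * c / \<alpha>"
  have k0: "0 \<le> ?K" "0 \<le> ?k" using const by auto
  have E_ineq: "?E r \<le> ?k * ?\<psi> 0 + ?K * ?J r T ?E" if r: "r \<in> {0..T}" for r
  proof -
    have r': "0 \<le> r" "r \<le> T" using r by auto
    have "?J r T (\<lambda>s. \<alpha> * ?D s - L * ?E s) \<le> ?J r T (\<lambda>s. ?gD s + ?fE s)"
      using strong int intD intE by (intro set_integral_clock_mono) auto
    also have "\<dots> = ?\<psi> r - ?\<psi> T" using \<psi>_diff[OF r' order_refl] by simp
    finally have "\<alpha> * ?J r T ?D - L * ?J r T ?E \<le> ?\<psi> r - ?\<psi> T"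
      using set_integral_clock_diff[of T "\<lambda>s. \<alpha> * ?D s" "\<lambda>s. L * ?E s" r T] intD intE by simp
    then have "\<alpha> * ?J r T ?D \<le> ?\<psi> 0 - ?\<psi> T + L * ?J r T ?E"
      using \<psi>_le[OF order_refl r'] by linarith
    then have JD: "?J r T ?D \<le> (?\<psi> 0 - ?\<psi> T + L * ?J r T ?E) / \<alpha>"
      using const(1) by (simp add: field_simps)
    have "?J r T ?gE \<le> ?J r T (\<lambda>s. c * (?D s + ?E s))"
      using bound_g int intD intE by (intro set_integral_clock_mono) auto
    also have "\<dots> = c * (?J r T ?D + ?J r T ?E)"
      using set_integral_clock_add[OF intD intE, of r T] by simp
    also have "\<dots> \<le> c * ((?\<psi> 0 - ?\<psi> T + L * ?J r T ?E) / \<alpha> + ?J r T ?E)"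
      using JD const(4) by (intro mult_left_mono) auto
    finally have gE: "?J r T ?gE \<le> c * ((?\<psi> 0 - ?\<psi> T + L * ?J r T ?E) / \<alpha> + ?J r T ?E)" .
    have "?E r \<le> (l2_norm M (Q r))\<^sup>2"
      using proj_E[OF r] by (intro power_mono l2_norm_nonneg)
    also have "\<dots> \<le> ?\<psi> T / a + 2 * (c * ((?\<psi> 0 - ?\<psi> T + L * ?J r T ?E) / \<alpha> + ?J r T ?E))"
      using Q_diff[OF r'] gE \<psi>T(2) by linarith
    also have "\<dots> = ?\<psi> T / a + 2 * c / \<alpha> * ?\<psi> 0 - 2 * c / \<alpha> * ?\<psi> T + ?K * ?J r T ?E"
      using const(1) by (simp add: field_simps)
    \<comment> \<open>$0 \le \psi(T) \le \psi(0)$\<close>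
    also have "\<dots> \<le> ?\<psi> 0 / a + 2 * c / \<alpha> * ?\<psi> 0 - 0 + ?K * ?J r T ?E"
      using \<psi>_le[of 0 T] \<psi>T(1) T const
      by (intro add_mono diff_mono divide_right_mono mult_nonneg_nonneg) auto
    also have "\<dots> = ?k * ?\<psi> 0 + ?K * ?J r T ?E" by (simp add: algebra_simps)
    finally show ?thesis .
  qed
  have \<psi>0: "0 \<le> ?\<psi> 0" using \<psi>_le[of 0 T] \<psi>T(1) T by simp
  have R0: "0 \<le> R" unfolding R using const by simp
  have E_le: "?E s \<le> R * ?\<psi> 0" if "s \<in> {0..T}" for s
  proof -
    have "?E s \<le> 2 * (?k * ?\<psi> 0) * exp (2 * ?K * T)"
      using k0(2) \<psi>0 by (intro gronwall_backward[OF intE _ _ k0(1) E_ineq that]) auto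
    also have "\<dots> = R * ?\<psi> 0" unfolding R by (simp only: mult_ac)
    finally show ?thesis .
  qed
  let ?d = "l2_norm M (D 0)"
  have zero: "0 \<in> {0..T}" using T by simp
  have \<psi>0_le: "?\<psi> 0 \<le> ?d * l2_norm M (E 0)"
    using l2_inner_le[OF has_l2_derivativeD(3)[OF D zero] E[OF zero]] proj_D[OF zero] by simp
  have d0: "0 \<le> ?d" by (rule l2_norm_nonneg)
  \<comment> \<open>$\|E_0\|^2 \le R\,\|D_0\|\,\|E_0\|$ is divided by $\|E_0\|$.\<close>
  have E0: "l2_norm M (E 0) \<le> R * ?d"
  proof (cases "l2_norm M (E 0) = 0")
    case True then show ?thesis using R0 d0 by simp
  next
    case False
    then have pos: "0 < l2_norm M (E 0)" using l2_norm_nonneg[of M "E 0"] by simp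
    have "?E 0 \<le> R * (?d * l2_norm M (E 0))"
      using E_le[OF zero] mult_left_mono[OF \<psi>0_le R0] by linarith
    then have "l2_norm M (E 0) * l2_norm M (E 0) \<le> (R * ?d) * l2_norm M (E 0)"
      by (simp add: power2_eq_square mult_ac)
    then show ?thesis using pos by simp
  qed
  have E_bound: "l2_norm M (E s) \<le> R * ?d" if s: "s \<in> {0..T}" for s
  proof -
    have "?E s \<le> R * (?d * (R * ?d))"
      using E_le[OF s] mult_left_mono[OF order_trans[OF \<psi>0_le mult_left_mono[OF E0 d0]] R0] by linarith
    then have "?E s \<le> (R * ?d)\<^sup>2" by (simp add: power2_eq_square mult_ac)
    then show ?thesis using R0 d0 by (simp add: power2_le_iff_abs_le l2_norm_nonneg)
  qed

  \<comment> \<open>With $E$ controlled by $D_0$, the forward equation alone bounds $D$.\<close>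
  let ?m = "max ?d (?d powr \<gamma>)"
  have m0: "0 \<le> ?m" using d0 by simp
  have "?D s \<le> ?m\<^sup>2 * (1 + 2 * c * T * (1 + R)\<^sup>2) + (2 * c) * ?J 0 s ?D" if s: "s \<in> {0..T}" for s
  proof -
    let ?B = "((1 + R) * ?m)\<^sup>2"
    have s': "0 \<le> s" "s \<le> T" using s by auto
    have const_int: "integrable (clock T) (\<lambda>_. ?B)"
      using finite_measure.integrable_const[OF finite_measure_clock] .
    have J1: "?J 0 s (\<lambda>_. ?B) = s * ?B"
      using s' by (simp add: set_integral_clock_const)
    have "?J 0 s (\<lambda>s. - c * (?D s + ?B)) \<le> ?J 0 s ?fD"
    proof (rule set_integral_clock_mono)
      fix r assume r: "r \<in> {0..T}"
      have "(max (l2_norm M (E r)) (l2_norm M (E r) powr \<gamma>))\<^sup>2 \<le> ?B"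
        using max_powr_bound[OF R0 d0 l2_norm_nonneg E_bound[OF r] const(5,6)] l2_norm_nonneg[of M "E r"]
        by (intro power_mono) auto
      then have "c * (?D r + (max (l2_norm M (E r)) (l2_norm M (E r) powr \<gamma>))\<^sup>2) \<le> c * (?D r + ?B)"
        using const(4) by (intro mult_left_mono) auto
      then show "- c * (?D r + ?B) \<le> ?fD r" using bound_f[OF r] by simp
    qed (use intD const_int int in auto)
    also have "?J 0 s (\<lambda>s. - c * (?D s + ?B)) = - c * (?J 0 s ?D + s * ?B)"
      unfolding Jscale using set_integral_clock_add[OF intD const_int, of 0 s] J1 by simp
    finally have "?D s \<le> ?D 0 + 2 * c * ?J 0 s ?D + 2 * c * (s * ?B)"
      using D_diff[OF s'] by (simp add: algebra_simps)
    also have "\<dots> \<le> ?m\<^sup>2 + 2 * c * ?J 0 s ?D + 2 * c * (T * ?B)"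
      using s' const(4) d0 by (intro add_mono mult_left_mono mult_right_mono power_mono) auto
    also have "\<dots> = ?m\<^sup>2 * (1 + 2 * c * T * (1 + R)\<^sup>2) + (2 * c) * ?J 0 s ?D"
      unfolding power_mult_distrib by (simp add: algebra_simps)
    finally show ?thesis .
  qed
  then have "?D t \<le> 2 * (?m\<^sup>2 * (1 + 2 * c * T * (1 + R)\<^sup>2)) * exp (2 * (2 * c) * T)"
    using const(4) T by (intro gronwall_forward[OF intD _ _ _ _ t]) auto
  also have "\<dots> = (2 * (1 + 2 * c * T * (1 + R)\<^sup>2) * exp (2 * (2 * c) * T)) * ?m\<^sup>2"
    by (simp add: mult_ac)
  finally have "sqrt (?D t) \<le> sqrt ((2 * (1 + 2 * c * T * (1 + R)\<^sup>2) * exp (2 * (2 * c) * T)) * ?m\<^sup>2)"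
    by (rule real_sqrt_le_mono)
  then show ?thesis
    using m0 by (simp add: real_sqrt_mult l2_norm_nonneg)
qed


section \<open>Stability of the forward-backward system\<close>

theorem lemma3p20:
  fixes M :: "'a measure"
    and T C\<^sub>1 C\<^sub>2 \<alpha> L a\<^sub>0 \<gamma> :: real
    and \<omega> :: "real \<Rightarrow> real"
    and W\<^sub>0 :: "real ^ 'n \<Rightarrow> (real ^ 'n) measure \<Rightarrow> real ^ 'n"
    and F G :: "real ^ 'n \<Rightarrow> (real ^ 'n) measure \<Rightarrow> real ^ 'n \<Rightarrow> real ^ 'n"
  assumes "prob_space M" and "T > 0"
    and "continuous_P2 W\<^sub>0"
    and "continuous_P2 (\<lambda>(x, u) \<mu>. F x \<mu> u)"
    and "continuous_P2 (\<lambda>(x, u) \<mu>. G x \<mu> u)"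
    and growth: "\<And>x \<mu> u. \<mu> \<in> P2 \<Longrightarrow>
        norm (W\<^sub>0 x \<mu>) + norm (F x \<mu> u) + norm (G x \<mu> u)
          \<le> C\<^sub>1 * (1 + norm x + norm u + sqrt (E2 \<mu>))"
    and "\<alpha> > 0" and "L \<ge> 0" and "a\<^sub>0 > 0"
    and mono_W0: "\<And>X Y. square_integrable M X \<Longrightarrow> square_integrable M Y \<Longrightarrow>
        l2_inner M (\<lambda>\<eta>. lift1 M W\<^sub>0 X \<eta> - lift1 M W\<^sub>0 Y \<eta>) (\<lambda>\<eta>. X \<eta> - Y \<eta>)
          \<ge> a\<^sub>0 * (l2_dist M (lift1 M W\<^sub>0 X) (lift1 M W\<^sub>0 Y))\<^sup>2"
    and mono_FG: "\<And>X Y U V. square_integrable M X \<Longrightarrow> square_integrable M Y \<Longrightarrow>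
        square_integrable M U \<Longrightarrow> square_integrable M V \<Longrightarrow>
        l2_inner M (\<lambda>\<eta>. lift2 M G X U \<eta> - lift2 M G Y V \<eta>) (\<lambda>\<eta>. X \<eta> - Y \<eta>)
          + l2_inner M (\<lambda>\<eta>. lift2 M F X U \<eta> - lift2 M F Y V \<eta>) (\<lambda>\<eta>. U \<eta> - V \<eta>) \<ge> 0"
    and strong_FG: "\<And>X Y U V. square_integrable M X \<Longrightarrow> square_integrable M Y \<Longrightarrow>
        square_integrable M U \<Longrightarrow> square_integrable M V \<Longrightarrow>
        l2_inner M (\<lambda>\<eta>. lift2 M G X U \<eta> - lift2 M G Y V \<eta>) (\<lambda>\<eta>. X \<eta> - Y \<eta>)
          + l2_inner M (\<lambda>\<eta>. lift2 M F X U \<eta> - lift2 M F Y V \<eta>) (\<lambda>\<eta>. U \<eta> - V \<eta>)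
          \<ge> \<alpha> * (l2_dist M X Y)\<^sup>2 - L * (l2_dist M U V)\<^sup>2"
    and "0 < \<gamma>" and "\<gamma> \<le> 1" and "modulus_of_continuity \<omega>"
    and bound_G: "\<And>X Y U V. square_integrable M X \<Longrightarrow> square_integrable M Y \<Longrightarrow>
        square_integrable M U \<Longrightarrow> square_integrable M V \<Longrightarrow>
        l2_inner M (\<lambda>\<eta>. lift2 M G X U \<eta> - lift2 M G Y V \<eta>) (\<lambda>\<eta>. U \<eta> - V \<eta>)
          \<le> C\<^sub>2 * ((l2_dist M X Y)\<^sup>2 + (l2_dist M U V)\<^sup>2)"
    and bound_F: "\<And>X Y U V. square_integrable M X \<Longrightarrow> square_integrable M Y \<Longrightarrow>
        square_integrable M U \<Longrightarrow> square_integrable M V \<Longrightarrow>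
        l2_inner M (\<lambda>\<eta>. lift2 M F X U \<eta> - lift2 M F Y V \<eta>) (\<lambda>\<eta>. X \<eta> - Y \<eta>)
          \<ge> - C\<^sub>2 * ((l2_dist M X Y)\<^sup>2 + (l2_dist_pow \<gamma> M U V)\<^sup>2)"
    and modulus: "\<And>x u \<mu> \<nu>. \<mu> \<in> P2 \<Longrightarrow> \<nu> \<in> P2 \<Longrightarrow>
        norm (F x \<mu> u - F x \<nu> u) + norm (G x \<mu> u - G x \<nu> u) + norm (W\<^sub>0 x \<mu> - W\<^sub>0 x \<nu>)
          \<le> \<omega> (wasserstein2 \<mu> \<nu>)"
  shows "\<exists>C. \<forall>\<sigma>\<^sub>x\<ge>0. \<forall>\<F> B X\<^sub>0 Y\<^sub>0 X Wx Zx Y Wy Zy.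
      filtered M \<F> \<and> brownian_motion_on M \<F> T B \<and>
      X\<^sub>0 \<in> borel_measurable (\<F> 0) \<and> square_integrable M X\<^sub>0 \<and>
      Y\<^sub>0 \<in> borel_measurable (\<F> 0) \<and> square_integrable M Y\<^sub>0 \<and>
      strong_solution M \<F> T B \<sigma>\<^sub>x W\<^sub>0 F G X\<^sub>0 X Wx Zx \<and>
      strong_solution M \<F> T B \<sigma>\<^sub>x W\<^sub>0 F G Y\<^sub>0 Y Wy Zy
      \<longrightarrow> (\<forall>t\<in>{0..T}. l2_dist M (X t) (Y t) \<le> C * l2_dist_pow \<gamma> M X\<^sub>0 Y\<^sub>0)"
proof -
  \<comment> \<open>The estimate needs a nonnegative constant, and $C_2$ may be negative.\<close>
  define c where "c = max C\<^sub>2 0"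
  define R where "R = 2 * (1 / a\<^sub>0 + 2 * c / \<alpha>) * exp (2 * (2 * c * (1 + L / \<alpha>)) * T)"
  define C where "C = sqrt (2 * (1 + 2 * c * T * (1 + R)\<^sup>2) * exp (2 * (2 * c) * T))"
  interpret prob_space M by fact
  note M = \<open>prob_space M\<close> and fM = finite_measure_axioms
  have growth_W0: "norm (W\<^sub>0 x \<mu>) \<le> C\<^sub>1 * (1 + norm x + sqrt (E2 \<mu>))"
    and growth_F: "norm (F x \<mu> u) \<le> C\<^sub>1 * (1 + norm x + norm u + sqrt (E2 \<mu>))"
    and growth_G: "norm (G x \<mu> u) \<le> C\<^sub>1 * (1 + norm x + norm u + sqrt (E2 \<mu>))"
    if "\<mu> \<in> P2" for x \<mu> u
    using growth[OF that, of x u] growth[OF that, of x 0]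
      norm_ge_zero[of "W\<^sub>0 x \<mu>"] norm_ge_zero[of "F x \<mu> u"] norm_ge_zero[of "G x \<mu> u"]
      norm_ge_zero[of "F x \<mu> 0"] norm_ge_zero[of "G x \<mu> 0"]
    by (auto simp del: norm_ge_zero)
  show ?thesis
  proof (intro exI[of _ C] allI impI ballI, elim conjE)
    fix \<sigma> :: real and \<F> :: "real \<Rightarrow> 'a measure" and B X\<^sub>0 Y\<^sub>0 X Wx Zx Y Wy Zy and t
    assume fil: "filtered M \<F>" and B: "brownian_motion_on M \<F> T B"
      and X0: "square_integrable M X\<^sub>0" and Y0: "square_integrable M Y\<^sub>0"
      and solX: "strong_solution M \<F> T B \<sigma> W\<^sub>0 F G X\<^sub>0 X Wx Zx"
      and solY: "strong_solution M \<F> T B \<sigma> W\<^sub>0 F G Y\<^sub>0 Y Wy Zy"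
      and t: "t \<in> {0..T}"
    note FX = strong_solution_coefficient[OF M fil assms(4) growth_F solX, simplified]
    note FY = strong_solution_coefficient[OF M fil assms(4) growth_F solY, simplified]
    note GX = strong_solution_coefficient[OF M fil assms(5) growth_G solX, simplified]
    note GY = strong_solution_coefficient[OF M fil assms(5) growth_G solY, simplified]
    have X: "square_integrable M (X s)" "X s \<in> borel_measurable (\<F> s)"
      and Wx: "square_integrable M (Wx s)" "Wx s \<in> borel_measurable (\<F> s)"
      and Y: "square_integrable M (Y s)" "Y s \<in> borel_measurable (\<F> s)"
      and Wy: "square_integrable M (Wy s)" "Wy s \<in> borel_measurable (\<F> s)"
      if "s \<in> {0..T}" for s
      using that solX solY by (auto simp: strong_solution_def adapted_on_def)
    have "\<forall>s\<in>{0..T}. \<exists>I. has_ito_integral M \<F> B Zx s T I \<and> (AE x in M.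
        Wx s x = lift1 M W\<^sub>0 (X T) x + (LINT r:{s..T}|lborel. lift2 M G (X r) (Wx r) x) - I x)"
      using solX by (simp add: strong_solution_def)
    then obtain Ix where "\<forall>s\<in>{0..T}. has_ito_integral M \<F> B Zx s T (Ix s) \<and> (AE x in M.
        Wx s x = lift1 M W\<^sub>0 (X T) x + (LINT r:{s..T}|lborel. lift2 M G (X r) (Wx r) x) - Ix s x)"
      by (auto dest!: bchoice)
    then have Ix: "has_ito_integral M \<F> B Zx s T (Ix s)" "AE x in M.
        Wx s x = lift1 M W\<^sub>0 (X T) x + (LINT r:{s..T}|lborel. lift2 M G (X r) (Wx r) x) - Ix s x"
      if "s \<in> {0..T}" for s using that by auto
    have "\<forall>s\<in>{0..T}. \<exists>I. has_ito_integral M \<F> B Zy s T I \<and> (AE x in M.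
        Wy s x = lift1 M W\<^sub>0 (Y T) x + (LINT r:{s..T}|lborel. lift2 M G (Y r) (Wy r) x) - I x)"
      using solY by (simp add: strong_solution_def)
    then obtain Iy where "\<forall>s\<in>{0..T}. has_ito_integral M \<F> B Zy s T (Iy s) \<and> (AE x in M.
        Wy s x = lift1 M W\<^sub>0 (Y T) x + (LINT r:{s..T}|lborel. lift2 M G (Y r) (Wy r) x) - Iy s x)"
      by (auto dest!: bchoice)
    then have Iy: "has_ito_integral M \<F> B Zy s T (Iy s)" "AE x in M.
        Wy s x = lift1 M W\<^sub>0 (Y T) x + (LINT r:{s..T}|lborel. lift2 M G (Y r) (Wy r) x) - Iy s x"
      if "s \<in> {0..T}" for s using that by auto

    \<comment> \<open>\<open>Q\<close> is the backward difference with its stochastic integral added back; \<open>q\<close> is its terminal value.\<close>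
    define D where "D = (\<lambda>s x. X s x - Y s x)"
    define E where "E = (\<lambda>s x. Wx s x - Wy s x)"
    define I where "I = (\<lambda>s x. Ix s x - Iy s x)"
    define Q where "Q = (\<lambda>s x. E s x + I s x)"
    define f where "f = (\<lambda>s x. lift2 M F (X s) (Wx s) x - lift2 M F (Y s) (Wy s) x)"
    define g where "g = (\<lambda>s x. lift2 M G (X s) (Wx s) x - lift2 M G (Y s) (Wy s) x)"
    define q where "q = (\<lambda>x. lift1 M W\<^sub>0 (X T) x - lift1 M W\<^sub>0 (Y T) x)"
    have zero: "0 \<in> {0..T}" and TT: "T \<in> {0..T}" using \<open>T > 0\<close> by auto
    have D: "square_integrable M (D s)" "D s \<in> borel_measurable (\<F> s)"
      and E: "square_integrable M (E s)" "E s \<in> borel_measurable (\<F> s)"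
      and f: "square_integrable M (f s)" "f s \<in> borel_measurable (\<F> s)"
      and g: "square_integrable M (g s)" "g s \<in> borel_measurable (\<F> s)"
      if s: "s \<in> {0..T}" for s
      using s X Y Wx Wy FX FY GX GY unfolding D_def E_def f_def g_def
      by (auto intro!: square_integrable_diff)
    have I2: "square_integrable M (I s)" if s: "s \<in> {0..T}" for s
      using Ix(1)[OF s] Iy(1)[OF s] unfolding I_def
      by (auto intro!: square_integrable_diff simp: has_ito_integral_def)
    have Q: "square_integrable M (Q s)" if s: "s \<in> {0..T}" for s
      unfolding Q_def using E(1)[OF s] I2[OF s] by (rule square_integrable_add)
    have q: "square_integrable M q"
      unfolding q_def
      by (intro square_integrable_diff square_integrable_lift1[OF M assms(3) growth_W0] X(1) Y(1) TT)
    have fP: "square_integrable (clock T \<Otimes>\<^sub>M M) (case_prod f)"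
      unfolding f_def by (intro square_integrable_process_diff FX(1) FY(1))
    have gP: "square_integrable (clock T \<Otimes>\<^sub>M M) (case_prod g)"
      unfolding g_def by (intro square_integrable_process_diff GX(1) GY(1))

    have orth: "l2_inner M V (I s) = 0"
      if s: "s \<in> {0..T}" and V: "V \<in> borel_measurable (\<F> s)" "square_integrable M V" for s V
    proof -
      have s0: "0 \<le> s" using s by simp
      have "square_integrable M (Ix s)" "square_integrable M (Iy s)"
        using Ix(1)[OF s] Iy(1)[OF s] by (auto simp: has_ito_integral_def)
      then show ?thesis
        using ito_integral_orthogonal[OF M fil B s0 Ix(1)[OF s] V]
          ito_integral_orthogonal[OF M fil B s0 Iy(1)[OF s] V] V(2)
        by (simp add: I_def l2_inner_diff_right)
    qed
    have proj: "l2_inner M V (Q s) = l2_inner M V (E s)"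
      if s: "s \<in> {0..T}" and V: "V \<in> borel_measurable (\<F> s)" "square_integrable M V" for s V
      using orth[OF s V] by (simp add: Q_def l2_inner_add_right E(1)[OF s] I2[OF s] V(2))

    have eqD: "AE x in M. D s x = (X\<^sub>0 x - Y\<^sub>0 x) + (LINT r:{0..s}|lborel. - f r x)" if s: "s \<in> {0..T}" for s
    proof -
      have sub: "{0..s} \<subseteq> {0..T}" using s by auto
      have "AE x in M. X s x = X\<^sub>0 x - (LINT r:{0..s}|lborel. lift2 M F (X r) (Wx r) x) + \<sigma> *\<^sub>R B s x"
        "AE x in M. Y s x = Y\<^sub>0 x - (LINT r:{0..s}|lborel. lift2 M F (Y r) (Wy r) x) + \<sigma> *\<^sub>R B s x"
        using solX solY s by (auto simp: strong_solution_def)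
      with AE_set_integrable_lborel[OF fM FX(1) sub] AE_set_integrable_lborel[OF fM FY(1) sub]
      show ?thesis
      proof eventually_elim
        case (elim x)
        have "(LINT r:{0..s}|lborel. - f r x) = - (LINT r:{0..s}|lborel. f r x)"
          by (simp add: set_lebesgue_integral_def)
        also have "\<dots> = - ((LINT r:{0..s}|lborel. lift2 M F (X r) (Wx r) x)
            - (LINT r:{0..s}|lborel. lift2 M F (Y r) (Wy r) x))"
          unfolding f_def by (subst set_integral_diff) (use elim in auto)
        finally show ?case using elim by (simp add: D_def)
      qed
    qed
    have eqQ: "AE x in M. Q s x = q x - (LINT r:{s..T}|lborel. - g r x)" if s: "s \<in> {0..T}" for s
    proof -
      have sub: "{s..T} \<subseteq> {0..T}" using s by auto
      from AE_set_integrable_lborel[OF fM GX(1) sub] AE_set_integrable_lborel[OF fM GY(1) sub]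
        Ix(2)[OF s] Iy(2)[OF s]
      show ?thesis
      proof eventually_elim
        case (elim x)
        have "(LINT r:{s..T}|lborel. - g r x) = - (LINT r:{s..T}|lborel. g r x)"
          by (simp add: set_lebesgue_integral_def)
        also have "\<dots> = - ((LINT r:{s..T}|lborel. lift2 M G (X r) (Wx r) x)
            - (LINT r:{s..T}|lborel. lift2 M G (Y r) (Wy r) x))"
          unfolding g_def by (subst set_integral_diff) (use elim in auto)
        finally show ?case using elim by (simp add: Q_def E_def I_def q_def)
      qed
    qed
    have derD: "has_l2_derivative M T D (\<lambda>s x. - f s x)"
      by (rule has_l2_derivative_forward[OF fM square_integrable_process_minus[OF fP] _ D(1)
            square_integrable_diff[OF X0 Y0] eqD])
        (rule square_integrable_minus[OF f(1)])
    have derQ: "has_l2_derivative M T Q (\<lambda>s x. - g s x)"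
      by (rule has_l2_derivative_backward[OF fM square_integrable_process_minus[OF gP] _ Q q eqQ])
        (rule square_integrable_minus[OF g(1)])
    \<comment> \<open>At the end points the time integral extends over a single point and vanishes.\<close>
    have D0: "l2_norm M (D 0) = l2_dist M X\<^sub>0 Y\<^sub>0"
      unfolding l2_dist_def using eqD[OF zero]
      by (intro l2_norm_cong_AE square_integrableD(1) D(1) zero square_integrable_diff X0 Y0)
        (simp only: set_integral_lborel_point add_0_right)
    have QT: "AE x in M. Q T x = q x"
      using eqQ[OF TT] by (simp only: set_integral_lborel_point diff_0_right)
    have C2: "C\<^sub>2 \<le> c" "0 \<le> c" by (auto simp: c_def)
    have "l2_norm M (D t) \<le> C * max (l2_norm M (D 0)) (l2_norm M (D 0) powr \<gamma>)"
      unfolding C_def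
    proof (rule forward_backward_estimate[OF fM \<open>T > 0\<close> \<open>\<alpha> > 0\<close> \<open>L \<ge> 0\<close> \<open>a\<^sub>0 > 0\<close> C2(2)
          \<open>0 < \<gamma>\<close> \<open>\<gamma> \<le> 1\<close> derD derQ, where E = E])
      have "square_integrable (clock T \<Otimes>\<^sub>M M) (case_prod D)" "square_integrable (clock T \<Otimes>\<^sub>M M) (case_prod E)"
        unfolding D_def E_def using solX solY
        by (auto simp: strong_solution_def time_prod_def intro!: square_integrable_process_diff)
      then show "integrable (clock T) (\<lambda>s. (l2_norm M (D s))\<^sup>2)" "integrable (clock T) (\<lambda>s. (l2_norm M (E s))\<^sup>2)"
        by (auto intro: integrable_l2_norm_square[OF finite_measure_clock fM])
      have "l2_norm M (Q T) = l2_norm M q"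
        by (intro l2_norm_cong_AE QT square_integrableD(1) Q q TT)
      moreover have "l2_inner M (D T) (Q T) = l2_inner M q (D T)"
        unfolding l2_inner_commute[of M "D T"]
        by (intro l2_inner_cong_AE QT square_integrableD(1) Q q TT D(1))
      ultimately show "a\<^sub>0 * (l2_norm M (Q T))\<^sup>2 \<le> l2_inner M (D T) (Q T)"
        using mono_W0[OF X(1)[OF TT] Y(1)[OF TT]] by (simp add: l2_dist_def q_def D_def)
      fix s assume s: "s \<in> {0..T}"
      show "square_integrable M (E s)" by (rule E(1)[OF s])
      show "l2_inner M (f s) (Q s) = l2_inner M (f s) (E s)" by (rule proj[OF s f(2,1)[OF s]])
      show "l2_inner M (g s) (Q s) = l2_inner M (g s) (E s)" by (rule proj[OF s g(2,1)[OF s]])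
      show "l2_inner M (D s) (Q s) = l2_inner M (D s) (E s)" by (rule proj[OF s D(2,1)[OF s]])
      show "l2_norm M (E s) \<le> l2_norm M (Q s)"
        unfolding Q_def
        by (rule orthogonal_perturbation[OF E(1)[OF s] I2[OF s] orth[OF s E(2,1)[OF s]]])
      note sq = X(1)[OF s] Y(1)[OF s] Wx(1)[OF s] Wy(1)[OF s]
      show "0 \<le> l2_inner M (g s) (D s) + l2_inner M (f s) (E s)"
        using mono_FG[OF sq] by (simp add: D_def E_def f_def g_def)
      show "\<alpha> * (l2_norm M (D s))\<^sup>2 - L * (l2_norm M (E s))\<^sup>2
          \<le> l2_inner M (g s) (D s) + l2_inner M (f s) (E s)"
        using strong_FG[OF sq] by (simp add: D_def E_def f_def g_def l2_dist_def)
      have "l2_inner M (g s) (E s) \<le> C\<^sub>2 * ((l2_norm M (D s))\<^sup>2 + (l2_norm M (E s))\<^sup>2)"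
        using bound_G[OF sq] by (simp add: D_def E_def g_def l2_dist_def)
      also have "\<dots> \<le> c * ((l2_norm M (D s))\<^sup>2 + (l2_norm M (E s))\<^sup>2)"
        by (rule mult_right_mono[OF C2(1)]) simp
      finally show "l2_inner M (g s) (E s) \<le> c * ((l2_norm M (D s))\<^sup>2 + (l2_norm M (E s))\<^sup>2)" .
      let ?S = "(l2_norm M (D s))\<^sup>2 + (max (l2_norm M (E s)) (l2_norm M (E s) powr \<gamma>))\<^sup>2"
      have "- c * ?S \<le> - C\<^sub>2 * ?S"
        using C2(1) by (intro mult_right_mono) auto
      also have "\<dots> \<le> l2_inner M (f s) (D s)"
        using bound_F[OF sq] by (simp add: D_def E_def f_def l2_dist_def l2_dist_pow_def)
      finally show "- c * ?S \<le> l2_inner M (f s) (D s)" .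
    qed (use R_def t in auto)
    then show "l2_dist M (X t) (Y t) \<le> C * l2_dist_pow \<gamma> M X\<^sub>0 Y\<^sub>0"
      by (simp add: D0 l2_dist_pow_def) (simp add: l2_dist_def D_def)
  qed
qed

end
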